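(* Let $n\ge1$. The bigraded Hilbert series of the space $R^{\pm}$ of diagonally $B_n$-alternating polynomials satisfies $$H_{q,t}(R^{\pm})=e_n\!\left[\frac{q+t}{(1-q^2)(1-t^2)}\right]=\Big(\sum_{\beta\in B_n}q^{\mathrm{fmaj}(\beta)}\,t^{\,n^2-\mathrm{fmaj}(\beta^{-1})}\Big)\prod_{i=1}^n\frac1{1-q^{2i}}\prod_{i=1}^n\frac1{1-t^{2i}}.$$
   Context: $B_n$ is the hyperoctahedral group of signed permutations of $[n]=\{1,\dots,n\}$, written in one-line notation $\beta=\beta(1)\cdots\beta(n)$, where each $\beta(i)$ is a nonzero integer and $\sigma(i):=|\beta(i)|$ defines a permutation of $[n]$; $\beta$ is extended by $\beta(-i)=-\beta(i)$, which defines products and inverses. A negative entry $-k$ is written $\bar k$. Let $R=\mathbb{Q}[x_1,\dots,x_n,y_1,\dots,y_n]$, bigraded by degree in the $x$'s and degree in the $y$'s. $B_n$ acts diagonally on $R$ by $\beta\cdot x_i=\pm x_{\sigma(i)}$ and $\beta\cdot y_i=\pm y_{\sigma(i)}$, the sign being that of $\beta(i)$. Then $R^{\pm}=\{p\in R\mid \beta\cdot p=\mathrm{sign}(\beta)\,p\ \text{for all }\beta\in B_n\}$, where $\mathrm{sign}(\beta)$ is the determinant of $\beta$ acting as a linear transformation on the span of $x_1,\dots,x_n$. For a bihomogeneous subspace $S$ of $R$ with components $S_{k,j}$ of bidegree $(k,j)$, $H_{q,t}(S)=\sum_{k,j\ge0}\dim(S_{k,j})q^kt^j$. Plethystic substitution: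 $e_n$ is the $n$-th elementary symmetric function; for an expression $w(q,t)$, $e_n[w]$ is obtained by writing $e_n$ as a polynomial in the power sums $p_k$ and replacing each $p_k$ by $w(q^k,t^k)$ (so $\sum_{n\ge0} e_n[w]z^n=\exp\big(\sum_{k\ge1}(-1)^{k-1}w(q^k,t^k)z^k/k\big)$). Use the linear order $\bar 1\prec\bar 2\prec\cdots\prec\bar n\prec 1\prec 2\prec\cdots\prec n$. Set $\mathrm{Des}(\beta)=\{i\in[n-1]\mid \beta(i)\succ\beta(i+1)\}$, $\mathrm{maj}(\beta)=\sum_{i\in \mathrm{Des}(\beta)}i$, $\mathrm{neg}(\beta)$ the number of negative entries of $\beta$, and $\mathrm{fmaj}(\beta)=2\,\mathrm{maj}(\beta)+\mathrm{neg}(\beta)$. *)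

theory Defs
  imports
    "HOL-Library.Poly_Mapping"
    "HOL-Computational_Algebra.Formal_Power_Series"
    "Jordan_Normal_Form.Determinant"
begin

text \<open>Polynomials over \<^typ>\<open>'a\<close> in variables \<^typ>\<open>'v\<close>: finitely supported maps from exponent vectors
  to coefficients, with the convolution product.\<close>

type_synonym ('v, 'a) mpoly = "('v \<Rightarrow>\<^sub>0 nat) \<Rightarrow>\<^sub>0 'a"

definition Const :: "'a::zero \<Rightarrow> ('v, 'a) mpoly" where
  "Const c = Poly_Mapping.single 0 c"

definition Var :: "'v \<Rightarrow> ('v, 'a::zero_neq_one) mpoly" where
  "Var v = Poly_Mapping.single (Poly_Mapping.single v 1) 1"

definition vars :: "('v, 'a::zero) mpoly \<Rightarrow> 'v set" where
  "vars p = (\<Union>m\<in>Poly_Mapping.keys p. Poly_Mapping.keys m)"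

definition subst ::
  "('a::zero \<Rightarrow> 'b::comm_ring_1) \<Rightarrow> ('v \<Rightarrow> 'b) \<Rightarrow> ('v, 'a) mpoly \<Rightarrow> 'b" where
  "subst \<iota> f p = (\<Sum>m\<in>Poly_Mapping.keys p. \<iota> (Poly_Mapping.lookup p m) *
     (\<Prod>v\<in>Poly_Mapping.keys m. f v ^ Poly_Mapping.lookup m v))"

definition scale :: "'a::comm_ring_1 \<Rightarrow> ('v, 'a) mpoly \<Rightarrow> ('v, 'a) mpoly" where
  "scale c p = Const c * p"

global_interpretation mpoly: vector_space "scale :: rat \<Rightarrow> ('v, rat) mpoly \<Rightarrow> ('v, rat) mpoly"
  defines mpoly_dim = mpoly.dim
  by unfold_locales
    (simp_all add: scale_def Const_def algebra_simps single_add mult_single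
      flip: mult.assoc)

text \<open>A signed permutation is an odd map on the integers; it is the identity beyond \<open>n\<close>, so that
  \<open>B n\<close> is a finite group under composition and the inverse function is the group inverse.\<close>

definition B :: "nat \<Rightarrow> (int \<Rightarrow> int) set" where
  "B n = {\<beta>. (\<forall>i. \<beta> (- i) = - \<beta> i) \<and>
             bij_betw (\<lambda>i. \<bar>\<beta> i\<bar>) {1..int n} {1..int n} \<and>
             (\<forall>i. \<bar>i\<bar> > int n \<longrightarrow> \<beta> i = i)}"

definition sprec :: "int \<Rightarrow> int \<Rightarrow> bool" (infix "\<prec>\<^sub>s" 50) where
  "a \<prec>\<^sub>s b \<longleftrightarrow> a < 0 \<and> 0 < b \<or> a < 0 \<and> b < 0 \<and> \<bar>a\<bar> < \<bar>b\<bar> \<or> 0 < a \<and> a < b"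

definition Des :: "nat \<Rightarrow> (int \<Rightarrow> int) \<Rightarrow> nat set" where
  "Des n \<beta> = {i\<in>{1..n - 1}. \<beta> (int (i + 1)) \<prec>\<^sub>s \<beta> (int i)}"

definition maj :: "nat \<Rightarrow> (int \<Rightarrow> int) \<Rightarrow> nat" where
  "maj n \<beta> = (\<Sum>i\<in>Des n \<beta>. i)"

definition neg :: "nat \<Rightarrow> (int \<Rightarrow> int) \<Rightarrow> nat" where
  "neg n \<beta> = card {i\<in>{1..n}. \<beta> (int i) < 0}"

definition fmaj :: "nat \<Rightarrow> (int \<Rightarrow> int) \<Rightarrow> nat" where
  "fmaj n \<beta> = 2 * maj n \<beta> + neg n \<beta>"

datatype xy = X nat | Y nat

definition R :: "nat \<Rightarrow> (xy, rat) mpoly set" where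
  "R n = {p. vars p \<subseteq> X ` {1..n} \<union> Y ` {1..n}}"

fun act_var :: "(int \<Rightarrow> int) \<Rightarrow> xy \<Rightarrow> (xy, rat) mpoly" where
  "act_var \<beta> (X i) = Const (of_int (sgn (\<beta> (int i)))) * Var (X (nat \<bar>\<beta> (int i)\<bar>))"
| "act_var \<beta> (Y i) = Const (of_int (sgn (\<beta> (int i)))) * Var (Y (nat \<bar>\<beta> (int i)\<bar>))"

definition act :: "(int \<Rightarrow> int) \<Rightarrow> (xy, rat) mpoly \<Rightarrow> (xy, rat) mpoly" where
  "act \<beta> = subst Const (act_var \<beta>)"

text \<open>Row and column indices of matrices start at \<open>0\<close>: column \<open>j\<close> holds the coordinates of
  the image of the variable \<open>X (j + 1)\<close>.\<close>

definition sign_B :: "nat \<Rightarrow> (int \<Rightarrow> int) \<Rightarrow> rat" where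
  "sign_B n \<beta> = Determinant.det (mat n n (\<lambda>(i, j).
     Poly_Mapping.lookup (act \<beta> (Var (X (j + 1)))) (Poly_Mapping.single (X (i + 1)) 1)))"

definition R_alt :: "nat \<Rightarrow> (xy, rat) mpoly set" where
  "R_alt n = {p\<in>R n. \<forall>\<beta>\<in>B n. act \<beta> p = scale (sign_B n \<beta>) p}"

definition deg_x :: "(xy \<Rightarrow>\<^sub>0 nat) \<Rightarrow> nat" where
  "deg_x m = (\<Sum>v\<in>Poly_Mapping.keys m \<inter> range X. Poly_Mapping.lookup m v)"

definition deg_y :: "(xy \<Rightarrow>\<^sub>0 nat) \<Rightarrow> nat" where
  "deg_y m = (\<Sum>v\<in>Poly_Mapping.keys m \<inter> range Y. Poly_Mapping.lookup m v)"

definition bihom :: "(xy, rat) mpoly set \<Rightarrow> nat \<Rightarrow> nat \<Rightarrow> (xy, rat) mpoly set" where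
  "bihom S k j = {p\<in>S. \<forall>m\<in>Poly_Mapping.keys p. deg_x m = k \<and> deg_y m = j}"

text \<open>The ring of formal power series in \<open>q\<close> and \<open>t\<close> is modelled as \<open>\<rat>[[q]][[t]]\<close>.\<close>

definition q_fps :: "rat fps fps" where "q_fps = fps_const fps_X"

definition t_fps :: "rat fps fps" where "t_fps = fps_X"

definition hilbert :: "(xy, rat) mpoly set \<Rightarrow> rat fps fps" where
  "hilbert S = Abs_fps (\<lambda>j. Abs_fps (\<lambda>k. of_nat (mpoly_dim (bihom S k j))))"

definition esym :: "nat \<Rightarrow> nat \<Rightarrow> (nat, rat) mpoly" where
  "esym n N = (\<Sum>A\<in>{A. A \<subseteq> {1..N} \<and> card A = n}. \<Prod>i\<in>A. Var i)"

definition psum :: "nat \<Rightarrow> nat \<Rightarrow> (nat, rat) mpoly" where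
  "psum k N = (\<Sum>i\<in>{1..N}. Var i ^ k)"

text \<open>The polynomial in indeterminates \<open>p\<^sub>1, p\<^sub>2, \<dots>\<close> that expresses \<open>e\<^sub>n\<close> in the power sums. An identity
  of symmetric functions is an identity of symmetric polynomials in every finite number \<open>N\<close> of
  variables. The polynomial exists by Newton's identities, and it is unique because the power sums
  are algebraically independent.\<close>

definition e_in_p :: "nat \<Rightarrow> (nat, rat) mpoly" where
  "e_in_p n = (SOME P. 0 \<notin> vars P \<and> (\<forall>N. subst Const (\<lambda>k. psum k N) P = esym n N))"

definition pleth_e ::
  "nat \<Rightarrow> (rat fps fps \<Rightarrow> rat fps fps \<Rightarrow> rat fps fps) \<Rightarrow> rat fps fps" where
  "pleth_e n w = subst (\<lambda>c. fps_const (fps_const c)) (\<lambda>k. w (q_fps ^ k) (t_fps ^ k)) (e_in_p n)"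

end

theory Submission
  imports Defs "HOL-Library.Product_Plus" "HOL-Library.FuncSet"
begin

text \<open>All three series count the same objects. Call a pair \<open>(a, b)\<close> with \<open>a + b\<close> odd a cell; the
  common value is the generating function, by coordinate sums, of the sets of \<open>n\<close> cells
  (\<open>cell_sets n\<close>).

  Hilbert series (\<open>hilbert_R_alt\<close>). A monomial in the \<open>x\<^sub>i, y\<^sub>i\<close> is a sequence of \<open>n\<close> exponent pairs. Sign
  changes of single coordinates force every pair that occurs in an alternating polynomial to be
  a cell, transpositions force the pairs to be distinct, and permuting the indices changes the
  coefficient by the sign of the permutation. So an alternating polynomial is determined by one
  coefficient for each set of \<open>n\<close> cells, and antisymmetrising one monomial for each set gives a
  basis dual to these coefficients.

  Plethysm (\<open>pleth_e_cells\<close>). The quotient \<open>(q + t) / ((1 - q\<^sup>2) (1 - t\<^sup>2))\<close> is the sum of \<open>q\<^sup>a t\<^sup>b\<close> over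
  the cells, and replacing \<open>q, t\<close> by their \<open>k\<close>-th powers gives the \<open>k\<close>-th power sum of these
  monomials (\<open>gf_cells\<close>). Hence the plethysm is \<open>e\<^sub>n\<close> evaluated at the infinitely many monomials
  \<open>q\<^sup>a t\<^sup>b\<close>, which is a sum over sets of \<open>n\<close> cells. To stay within finitely many variables
  everything is computed up to a given bidegree. That \<open>e\<^sub>n\<close> is a polynomial in the power sums is
  Newton's recursion (\<open>esym_in_psums\<close>).

  Signed permutations (\<open>gf_cell_sets\<close>). This is a signed form of the Garsia-Gessel encoding of
  bipartite partitions. List a set of \<open>n\<close> cells by decreasing first coordinate, ties by
  decreasing second coordinate, and list it again by decreasing second coordinate, ties by
  increasing first coordinate. The passage between the two lists is a permutation; signing its
  values by the parity of the first coordinate makes it an element \<open>\<beta>\<close> of \<open>B n\<close>. The first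
  coordinates form a weakly decreasing sequence of prescribed parities whose forced strict steps
  are the descents of \<open>\<beta>\<close>, so the smallest admissible one has sum \<open>fmaj n \<beta>\<close> and the others are
  obtained by adding twice a partition. The second coordinates behave in the same way with
  respect to the ascents of the inverse, where the smallest sum is the complement of its \<open>fmaj\<close>
  in \<open>n\<^sup>2\<close>.\<close>

unbundle fps_syntax
no_notation vec_index (infixl "$" 100)

section \<open>Generating functions in two variables\<close>

definition qt_monom :: "nat \<times> nat \<Rightarrow> rat fps fps" where
  "qt_monom w = q_fps ^ fst w * t_fps ^ snd w"

lemma qt_monom_nth: "qt_monom w $ j $ k = (if w = (k, j) then 1 else 0)"
proof -
  have "q_fps ^ fst w = fps_const (fps_X ^ fst w)"
    by (simp add: q_fps_def fps_const_power)
  then show ?thesis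
    by (cases w) (auto simp: qt_monom_def t_fps_def fps_X_power_nth)
qed

lemma qt_monom_add: "qt_monom (u + v) = qt_monom u * qt_monom v"
  by (simp add: qt_monom_def power_add)

lemma qt_monom_zero [simp]: "qt_monom 0 = 1"
  by (simp add: qt_monom_def)

lemma qt_monom_sum: "qt_monom (\<Sum>x\<in>A. w x) = (\<Prod>x\<in>A. qt_monom (w x))"
  by (induction A rule: infinite_finite_induct) (simp_all add: qt_monom_add)

definition gf :: "'a set \<Rightarrow> ('a \<Rightarrow> nat \<times> nat) \<Rightarrow> rat fps fps" where
  "gf A w = Abs_fps (\<lambda>j. Abs_fps (\<lambda>k. of_nat (card {x\<in>A. w x = (k, j)})))"

text \<open>Coefficients of \<open>gf\<close> are cardinalities, and the cardinality of an infinite set is \<open>0\<close>, so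
  the sum and product rules hold only for weights with finite fibres.\<close>

definition finite_fibres :: "'a set \<Rightarrow> ('a \<Rightarrow> 'b) \<Rightarrow> bool" where
  "finite_fibres A w \<longleftrightarrow> (\<forall>c. finite {x\<in>A. w x = c})"

lemma gf_nth: "gf A w $ j $ k = of_nat (card {x\<in>A. w x = (k, j)})"
  by (simp add: gf_def)

lemma fps_fps_eqI: "(\<And>j k. F $ j $ k = G $ j $ k) \<Longrightarrow> F = G"
  by (simp add: fps_eq_iff)

lemma gf_bij:
  assumes "bij_betw h A A'" "\<And>x. x \<in> A \<Longrightarrow> w' (h x) = w x"
  shows "gf A w = gf A' w'"
proof (rule fps_fps_eqI)
  fix j k
  have "bij_betw h {x\<in>A. w x = (k, j)} {x\<in>A'. w' x = (k, j)}"
    using assms unfolding bij_betw_def inj_on_def by (auto simp: image_iff)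
  then show "gf A w $ j $ k = gf A' w' $ j $ k"
    by (simp add: gf_nth bij_betw_same_card)
qed

lemma finite_fibres_bij:
  assumes "bij_betw h A A'" "\<And>x. x \<in> A \<Longrightarrow> w' (h x) = w x" "finite_fibres A w"
  shows "finite_fibres A' w'"
  unfolding finite_fibres_def
proof
  fix c
  have "{y\<in>A'. w' y = c} \<subseteq> h ` {x\<in>A. w x = c}"
    using assms(1,2) by (auto simp: bij_betw_def)
  moreover have "finite {x\<in>A. w x = c}" using assms(3) by (simp add: finite_fibres_def)
  ultimately show "finite {y\<in>A'. w' y = c}" by (rule finite_subset[OF _ finite_imageI])
qed

lemma finite_fibres_finite [simp]: "finite A \<Longrightarrow> finite_fibres A w"
  by (simp add: finite_fibres_def)

lemma gf_finite:
  assumes "finite A"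
  shows "gf A w = (\<Sum>x\<in>A. qt_monom (w x))"
proof (rule fps_fps_eqI)
  fix j k
  have "(\<Sum>x\<in>A. qt_monom (w x)) $ j $ k = (\<Sum>x\<in>A. if w x = (k, j) then 1 else 0)"
    by (simp add: fps_sum_nth qt_monom_nth)
  also have "\<dots> = of_nat (card {x\<in>A. w x = (k, j)})"
    using assms by (simp add: sum.If_cases Int_def)
  finally show "gf A w $ j $ k = (\<Sum>x\<in>A. qt_monom (w x)) $ j $ k"
    by (simp add: gf_nth)
qed

lemma gf_Un:
  assumes "finite_fibres A w" "finite_fibres A' w" "A \<inter> A' = {}"
  shows "gf (A \<union> A') w = gf A w + gf A' w"
proof (rule fps_fps_eqI)
  fix j k
  have "{x\<in>A \<union> A'. w x = (k, j)} = {x\<in>A. w x = (k, j)} \<union> {x\<in>A'. w x = (k, j)}" by auto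
  moreover have "{x\<in>A. w x = (k, j)} \<inter> {x\<in>A'. w x = (k, j)} = {}" using assms by auto
  ultimately show "gf (A \<union> A') w $ j $ k = (gf A w + gf A' w) $ j $ k"
    using assms by (simp add: gf_nth card_Un_disjoint finite_fibres_def)
qed

lemma gf_Sigma:
  assumes "finite I" "\<And>i. i \<in> I \<Longrightarrow> finite_fibres (A i) (w i)"
  shows "gf (Sigma I A) (\<lambda>(i, x). w i x) = (\<Sum>i\<in>I. gf (A i) (w i))"
proof (rule fps_fps_eqI)
  fix j k
  have "{y\<in>Sigma I A. (case y of (i, x) \<Rightarrow> w i x) = (k, j)}
      = Sigma I (\<lambda>i. {x\<in>A i. w i x = (k, j)})" by auto
  then show "gf (Sigma I A) (\<lambda>(i, x). w i x) $ j $ k = (\<Sum>i\<in>I. gf (A i) (w i)) $ j $ k"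
    using assms by (simp add: gf_nth fps_sum_nth card_SigmaI finite_fibres_def)
qed

lemma
  assumes fin: "finite_fibres A u" "finite_fibres A' v"
  shows gf_Times: "gf (A \<times> A') (\<lambda>(x, y). u x + v y) = gf A u * gf A' v"
    and finite_fibres_Times:
      "finite_fibres (A \<times> A') (\<lambda>(x, y). (u x + v y) :: nat \<times> nat)"
proof -
  define P where "P k j i l = {x\<in>A. u x = (l, i)} \<times> {y\<in>A'. v y = (k - l, j - i)}" for k j i l
  have fibre: "{z\<in>A \<times> A'. (case z of (x, y) \<Rightarrow> u x + v y) = (k, j)}
      = (\<Union>(i, l)\<in>{0..j} \<times> {0..k}. P k j i l)" for k j
  proof (intro equalityI subsetI)
    fix z assume z: "z \<in> {z\<in>A \<times> A'. (case z of (x, y) \<Rightarrow> u x + v y) = (k, j)}"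
    obtain x y where xy: "z = (x, y)" by (cases z)
    obtain l i where li: "u x = (l, i)" by (cases "u x")
    obtain l' i' where li': "v y = (l', i')" by (cases "v y")
    have "l + l' = k" "i + i' = j" using z xy li li' by auto
    then have "z \<in> P k j i l" "(i, l) \<in> {0..j} \<times> {0..k}"
      using z xy li li' by (auto simp: P_def)
    then show "z \<in> (\<Union>(i, l)\<in>{0..j} \<times> {0..k}. P k j i l)" by blast
  qed (auto simp: P_def)
  have finP: "finite (P k j i l)" for k j i l
    using fin by (simp add: P_def finite_fibres_def)
  have card_P: "card (P k j i l) = card {x\<in>A. u x = (l, i)} * card {y\<in>A'. v y = (k - l, j - i)}"
    for k j i l
    by (simp add: P_def card_cartesian_product)
  show "finite_fibres (A \<times> A') (\<lambda>(x, y). (u x + v y) :: nat \<times> nat)"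
    unfolding finite_fibres_def
  proof
    fix c :: "nat \<times> nat"
    show "finite {z\<in>A \<times> A'. (case z of (x, y) \<Rightarrow> u x + v y) = c}"
      using fibre[of "fst c" "snd c"] finP by auto
  qed
  show "gf (A \<times> A') (\<lambda>(x, y). u x + v y) = gf A u * gf A' v"
  proof (rule fps_fps_eqI)
    fix j k
    have "card (\<Union>(i, l)\<in>{0..j} \<times> {0..k}. P k j i l)
        = (\<Sum>(i, l)\<in>{0..j} \<times> {0..k}. card (P k j i l))"
      using finP by (subst card_UN_disjoint) (auto simp: P_def case_prod_unfold simp del: finite_Collect_conjI)
    then show "gf (A \<times> A') (\<lambda>(x, y). u x + v y) $ j $ k = (gf A u * gf A' v) $ j $ k"
      unfolding gf_nth fibre
      by (simp add: fps_mult_nth gf_nth fps_sum_nth sum.cartesian_product case_prod_unfold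
          card_P)
  qed
qed

lemma gf_shift:
  assumes "finite_fibres A w"
  shows "gf A (\<lambda>x. c + w x) = qt_monom c * gf A w"
proof -
  have "gf A (\<lambda>x. c + w x) = gf ({()} \<times> A) (\<lambda>(i, x). c + w x)"
    by (rule gf_bij[where h = "\<lambda>x. ((), x)"]) (auto simp: bij_betw_def inj_on_def)
  also have "\<dots> = gf {()} (\<lambda>_. c) * gf A w"
    using gf_Times[of "{()}" "\<lambda>_. c" A w] assms by simp
  finally show ?thesis by (simp add: gf_finite)
qed

lemma finite_fibres_shift:
  assumes "finite_fibres A w"
  shows "finite_fibres A (\<lambda>x. c + w x :: nat \<times> nat)"
  unfolding finite_fibres_def
proof
  fix d
  have "{x\<in>A. c + w x = d} \<subseteq> {x\<in>A. w x = d - c}" by auto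
  moreover have "finite {x\<in>A. w x = d - c}" using assms unfolding finite_fibres_def by blast
  ultimately show "finite {x\<in>A. c + w x = d}" by (rule finite_subset)
qed

text \<open>Division in \<open>\<rat>[[q]][[t]]\<close> is not division in a field, so a quotient has to be
  recognised through a product.\<close>

lemma fps_fps_divide_mult:
  fixes G H :: "rat fps fps"
  assumes "G $ 0 $ 0 \<noteq> 0"
  shows "H / G * G = H"
proof -
  have unit: "G $ 0 * inverse (G $ 0) = 1"
    using assms by (rule inverse_mult_eq_1')
  then have "G * inverse G = 1"
    unfolding fps_inverse_def[of G] by (rule fps_right_inverse)
  moreover have "G $ 0 \<noteq> 0" using unit by auto
  ultimately show ?thesis by (simp add: fps_divide_unit mult.assoc mult.commute[of G])
qed

lemma fps_fps_divide_eqI: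
  fixes F G H :: "rat fps fps"
  assumes "G $ 0 $ 0 \<noteq> 0" "F * G = H"
  shows "H / G = F"
proof -
  have "G \<noteq> 0" using assms(1) by auto
  moreover have "H / G * G = F * G" using fps_fps_divide_mult[OF assms(1)] assms(2) by simp
  ultimately show ?thesis by simp
qed

definition scale_weight :: "nat \<Rightarrow> nat \<times> nat \<Rightarrow> nat \<times> nat" where
  "scale_weight i c = (i * fst c, i * snd c)"

lemma qt_monom_scale: "qt_monom (scale_weight i c) = qt_monom c ^ i"
  by (simp add: scale_weight_def qt_monom_def power_mult_distrib mult.commute flip: power_mult)

text \<open>The geometric series, from the recursion that splits off \<open>0\<close> from the natural numbers.\<close>

lemma
  assumes "c \<noteq> (0, 0)"
  shows finite_fibres_multiples: "finite_fibres UNIV (\<lambda>i. scale_weight i c)"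
    and gf_multiples: "gf UNIV (\<lambda>i. scale_weight i c) = 1 / (1 - qt_monom c)"
proof -
  let ?w = "\<lambda>i. scale_weight i c"
  have inj: "inj ?w"
    using assms by (cases c) (auto simp: inj_on_def scale_weight_def)
  show fin: "finite_fibres UNIV ?w"
    unfolding finite_fibres_def
  proof
    fix d
    have "{i\<in>UNIV. ?w i = d} = ?w -` {d}" by auto
    then show "finite {i\<in>UNIV. ?w i = d}" using finite_vimageI[OF _ inj, of "{d}"] by simp
  qed
  then have fin': "finite_fibres (range Suc) ?w"
    unfolding finite_fibres_def by (auto intro: finite_subset[rotated])
  have "gf UNIV ?w = gf ({0} \<union> range Suc) ?w"
    by (rule arg_cong[where f = "\<lambda>A. gf A ?w"]) (use not0_implies_Suc in auto)
  also have "\<dots> = gf {0} ?w + gf (range Suc) ?w"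
    by (rule gf_Un) (use fin' in auto)
  also have "gf {0} ?w = 1"
    by (simp add: gf_finite scale_weight_def qt_monom_def)
  also have "gf (range Suc) ?w = gf UNIV (\<lambda>i. c + ?w i)"
    by (rule gf_bij[symmetric, where h = Suc]) (auto simp: bij_betw_def scale_weight_def prod_eq_iff)
  also have "\<dots> = qt_monom c * gf UNIV ?w"
    by (rule gf_shift[OF fin])
  finally have "gf UNIV ?w * (1 - qt_monom c) = 1"
    by (simp add: algebra_simps)
  then show "gf UNIV ?w = 1 / (1 - qt_monom c)"
    using assms by (intro fps_fps_divide_eqI[symmetric]) (auto simp: qt_monom_nth)
qed

lemma
  fixes w :: "'i \<Rightarrow> 'a \<Rightarrow> nat \<times> nat"
  assumes "finite I" "\<And>i. i \<in> I \<Longrightarrow> finite_fibres (A i) (w i)"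
  shows gf_PiE: "gf (PiE I A) (\<lambda>m. \<Sum>i\<in>I. w i (m i)) = (\<Prod>i\<in>I. gf (A i) (w i))"
    and finite_fibres_PiE: "finite_fibres (PiE I A) (\<lambda>m. \<Sum>i\<in>I. w i (m i))"
proof -
  have "gf (PiE I A) (\<lambda>m. \<Sum>i\<in>I. w i (m i)) = (\<Prod>i\<in>I. gf (A i) (w i)) \<and>
    finite_fibres (PiE I A) (\<lambda>m. \<Sum>i\<in>I. w i (m i))"
    using assms
  proof (induction I)
    case empty
    then show ?case by (simp add: gf_finite)
  next
    case (insert i I)
    let ?h = "\<lambda>(x, m). m(i := x)"
    let ?w = "\<lambda>(x, m). w i x + (\<Sum>i\<in>I. w i (m i))"
    have bij: "bij_betw ?h (A i \<times> PiE I A) (PiE (insert i I) A)"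
      using inj_combinator[of i I A] insert.hyps by (simp add: bij_betw_def PiE_insert_eq)
    have w: "(\<Sum>j\<in>insert i I. w j (?h z j)) = ?w z" if "z \<in> A i \<times> PiE I A" for z
    proof -
      have "(\<Sum>j\<in>I. w j (((snd z)(i := fst z)) j)) = (\<Sum>j\<in>I. w j (snd z j))"
        by (rule sum.cong) (use insert.hyps in auto)
      then show ?thesis using insert.hyps by (simp add: case_prod_unfold del: fun_upd_apply) simp
    qed
    have fin: "finite_fibres (A i) (w i)" "finite_fibres (PiE I A) (\<lambda>m. \<Sum>i\<in>I. w i (m i))"
      using insert by auto
    let ?w' = "\<lambda>m. \<Sum>i\<in>insert i I. w i (m i)"
    have "gf (PiE (insert i I) A) ?w' = gf (A i) (w i) * gf (PiE I A) (\<lambda>m. \<Sum>i\<in>I. w i (m i))"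
      using gf_bij[where w' = ?w', OF bij w] gf_Times[OF fin] by simp
    moreover have "finite_fibres (PiE (insert i I) A) ?w'"
      using finite_fibres_bij[where w' = ?w', OF bij w finite_fibres_Times[OF fin]] .
    ultimately show ?case
      using insert by simp
  qed
  then show "gf (PiE I A) (\<lambda>m. \<Sum>i\<in>I. w i (m i)) = (\<Prod>i\<in>I. gf (A i) (w i))"
    and "finite_fibres (PiE I A) (\<lambda>m. \<Sum>i\<in>I. w i (m i))" by auto
qed

section \<open>Truncation\<close>

text \<open>A polynomial expression in series can be compared with one in finitely many monomials because
  equality up to a bidegree is a congruence.\<close>

definition agree_upto :: "nat \<Rightarrow> rat fps fps \<Rightarrow> rat fps fps \<Rightarrow> bool" where
  "agree_upto d F G \<longleftrightarrow> (\<forall>j\<le>d. \<forall>k\<le>d. F $ j $ k = G $ j $ k)"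

lemma agree_upto_refl [simp]: "agree_upto d F F"
  by (simp add: agree_upto_def)

lemma agree_upto_sym: "agree_upto d F G \<Longrightarrow> agree_upto d G F"
  by (simp add: agree_upto_def)

lemma agree_upto_trans [trans]: "agree_upto d F G \<Longrightarrow> agree_upto d G H \<Longrightarrow> agree_upto d F H"
  by (simp add: agree_upto_def)

lemma agree_upto_add: "agree_upto d F F' \<Longrightarrow> agree_upto d G G' \<Longrightarrow> agree_upto d (F + G) (F' + G')"
  by (simp add: agree_upto_def)

lemma agree_upto_mult: "agree_upto d F F' \<Longrightarrow> agree_upto d G G' \<Longrightarrow> agree_upto d (F * G) (F' * G')"
  by (simp add: agree_upto_def fps_mult_nth fps_sum_nth)

lemma agree_upto_sum: "(\<And>x. x \<in> A \<Longrightarrow> agree_upto d (F x) (G x)) \<Longrightarrow> agree_upto d (sum F A) (sum G A)"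
  by (induction A rule: infinite_finite_induct) (auto intro: agree_upto_add)

lemma agree_upto_prod: "(\<And>x. x \<in> A \<Longrightarrow> agree_upto d (F x) (G x)) \<Longrightarrow> agree_upto d (prod F A) (prod G A)"
  by (induction A rule: infinite_finite_induct) (auto intro: agree_upto_mult)

lemma agree_upto_power: "agree_upto d F G \<Longrightarrow> agree_upto d (F ^ k) (G ^ k)"
  by (induction k) (auto intro: agree_upto_mult)

lemma gf_truncate:
  assumes "finite A'" "A' \<subseteq> A" "\<And>x. x \<in> A \<Longrightarrow> fst (w x) \<le> d \<Longrightarrow> snd (w x) \<le> d \<Longrightarrow> x \<in> A'"
  shows "agree_upto d (gf A w) (\<Sum>x\<in>A'. qt_monom (w x))"
  unfolding agree_upto_def
proof (intro allI impI)
  fix j k assume "j \<le> d" "k \<le> d"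
  then have "{x\<in>A. w x = (k, j)} = {x\<in>A'. w x = (k, j)}"
    using assms by force
  then show "gf A w $ j $ k = (\<Sum>x\<in>A'. qt_monom (w x)) $ j $ k"
    by (simp add: gf_finite[OF assms(1), symmetric] gf_nth)
qed

section \<open>Substitution is a ring homomorphism\<close>

lemma poly_mapping_sum_singles:
  "p = (\<Sum>m\<in>Poly_Mapping.keys p. Poly_Mapping.single m (Poly_Mapping.lookup p m))"
proof (rule poly_mapping_eqI)
  fix m
  have "Poly_Mapping.lookup (\<Sum>m\<in>Poly_Mapping.keys p.
        Poly_Mapping.single m (Poly_Mapping.lookup p m)) m
      = (\<Sum>m'\<in>Poly_Mapping.keys p. if m = m' then Poly_Mapping.lookup p m' else 0)"
    unfolding lookup_sum by (rule sum.cong) (auto simp: lookup_single when_def)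
  then show "Poly_Mapping.lookup p m = Poly_Mapping.lookup (\<Sum>m\<in>Poly_Mapping.keys p.
      Poly_Mapping.single m (Poly_Mapping.lookup p m)) m"
    by (simp add: in_keys_iff)
qed

lemma monom_value_superset:
  fixes f :: "'v \<Rightarrow> 'b::comm_ring_1"
  assumes "finite A" "Poly_Mapping.keys m \<subseteq> A"
  shows "(\<Prod>v\<in>Poly_Mapping.keys m. f v ^ Poly_Mapping.lookup m v)
    = (\<Prod>v\<in>A. f v ^ Poly_Mapping.lookup m v)"
  by (rule prod.mono_neutral_left) (use assms in \<open>auto simp: in_keys_iff\<close>)

lemma monom_value_add:
  fixes f :: "'v \<Rightarrow> 'b::comm_ring_1"
  shows "(\<Prod>v\<in>Poly_Mapping.keys (m + m'). f v ^ Poly_Mapping.lookup (m + m') v)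
    = (\<Prod>v\<in>Poly_Mapping.keys m. f v ^ Poly_Mapping.lookup m v)
      * (\<Prod>v\<in>Poly_Mapping.keys m'. f v ^ Poly_Mapping.lookup m' v)"
proof -
  let ?A = "Poly_Mapping.keys m \<union> Poly_Mapping.keys m'"
  have "finite ?A" "Poly_Mapping.keys (m + m') \<subseteq> ?A" by (auto intro!: keys_add[THEN subsetD])
  then show ?thesis
    using monom_value_superset[of ?A m f] monom_value_superset[of ?A m' f]
      monom_value_superset[of ?A "m + m'" f]
    by (simp add: lookup_add power_add prod.distrib)
qed

context comm_ring_hom
begin

lemma subst_superset:
  assumes "finite A" "Poly_Mapping.keys p \<subseteq> A"
  shows "subst hom f p = (\<Sum>m\<in>A. hom (Poly_Mapping.lookup p m) *
     (\<Prod>v\<in>Poly_Mapping.keys m. f v ^ Poly_Mapping.lookup m v))"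
  unfolding subst_def
  by (rule sum.mono_neutral_left) (use assms in \<open>auto simp: in_keys_iff\<close>)

lemma subst_single: "subst hom f (Poly_Mapping.single m c)
    = hom c * (\<Prod>v\<in>Poly_Mapping.keys m. f v ^ Poly_Mapping.lookup m v)"
  using subst_superset[of "{m}" "Poly_Mapping.single m c" f] by simp

lemma subst_zero: "subst hom f 0 = 0"
  by (simp add: subst_def)

lemma subst_add: "subst hom f (p + p') = subst hom f p + subst hom f p'"
proof -
  let ?A = "Poly_Mapping.keys p \<union> Poly_Mapping.keys p'"
  have "finite ?A" "Poly_Mapping.keys (p + p') \<subseteq> ?A" by (auto intro!: keys_add[THEN subsetD])
  then show ?thesis
    using subst_superset[of ?A p f] subst_superset[of ?A p' f] subst_superset[of ?A "p + p'" f]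
    by (simp add: lookup_add hom_add distrib_right sum.distrib)
qed

lemma subst_sum: "subst hom f (\<Sum>i\<in>A. p i) = (\<Sum>i\<in>A. subst hom f (p i))"
  by (induction A rule: infinite_finite_induct) (simp_all add: subst_zero subst_add)

lemma subst_mult: "subst hom f (p * p') = subst hom f p * subst hom f p'"
proof -
  let ?s = "\<lambda>p m. Poly_Mapping.single m (Poly_Mapping.lookup p m)"
  have single: "subst hom f (Poly_Mapping.single m c * Poly_Mapping.single m' c')
      = subst hom f (Poly_Mapping.single m c) * subst hom f (Poly_Mapping.single m' c')" for m c m' c'
    by (simp add: mult_single subst_single monom_value_add hom_mult algebra_simps)
  have "subst hom f (sum (?s p) (Poly_Mapping.keys p) * sum (?s p') (Poly_Mapping.keys p'))
      = subst hom f (sum (?s p) (Poly_Mapping.keys p)) * subst hom f (sum (?s p') (Poly_Mapping.keys p'))"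
    by (simp add: sum_product subst_sum single)
  then show ?thesis by (simp flip: poly_mapping_sum_singles)
qed

lemma subst_Const: "subst hom f (Const c) = hom c"
  by (simp add: Const_def subst_single)

lemma subst_one: "subst hom f 1 = 1"
  using subst_Const[of f 1] by (simp add: Const_def)

lemma subst_Var: "subst hom f (Var v) = f v"
  by (simp add: Var_def subst_single)

lemma subst_prod: "subst hom f (\<Prod>i\<in>A. p i) = (\<Prod>i\<in>A. subst hom f (p i))"
  by (induction A rule: infinite_finite_induct) (simp_all add: subst_one subst_mult)

lemma subst_power: "subst hom f (p ^ k) = subst hom f p ^ k"
  by (induction k) (simp_all add: subst_one subst_mult)

lemma subst_subst: "subst hom g (subst Const f p) = subst hom (\<lambda>v. subst hom g (f v)) p"
  unfolding subst_def[of Const] subst_sum subst_mult subst_prod subst_power subst_Const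
  by (simp add: subst_def)

end

lemma comm_ring_hom_Const: "comm_ring_hom (Const :: 'a::comm_ring_1 \<Rightarrow> ('v, 'a) mpoly)"
  by unfold_locales (simp_all add: Const_def single_add mult_single)

section \<open>Elementary symmetric functions in terms of power sums\<close>

lemma prod_one_plus_X_nth:
  fixes x :: "'i \<Rightarrow> 'r::comm_ring_1"
  assumes "finite S"
  shows "(\<Prod>i\<in>S. 1 + fps_const (x i) * fps_X) $ k = (\<Sum>A\<in>{A. A \<subseteq> S \<and> card A = k}. \<Prod>i\<in>A. x i)"
  using assms
proof (induction S arbitrary: k)
  case empty
  have "{A. A \<subseteq> ({}::'i set) \<and> card A = k} = (if k = 0 then {{}} else {})" by auto
  then show ?case by simp
next
  case (insert i S)
  let ?E = "\<lambda>S k. {A. A \<subseteq> S \<and> card A = k}"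
  let ?c = "\<lambda>S k. \<Sum>A\<in>?E S k. \<Prod>i\<in>A. x i"
  let ?P = "\<Prod>i\<in>S. 1 + fps_const (x i) * fps_X"
  have "(\<Prod>i\<in>insert i S. 1 + fps_const (x i) * fps_X) = ?P + fps_const (x i) * (fps_X * ?P)"
    using insert.hyps by (simp add: algebra_simps)
  then have lhs: "(\<Prod>i\<in>insert i S. 1 + fps_const (x i) * fps_X) $ k
      = ?c S k + (if k = 0 then 0 else x i * ?c S (k - 1))"
    using insert.IH by simp
  show ?case
  proof (cases k)
    case 0
    have "?E S 0 = {{}}" "?E (insert i S) 0 = {{}}"
      using insert.hyps finite_subset by (auto simp: finite_subset)
    then show ?thesis using lhs 0 by simp
  next
    case (Suc l)
    have fin: "finite A" if "A \<subseteq> S" for A using that insert.hyps finite_subset by blast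
    have split: "?E (insert i S) k = ?E S k \<union> insert i ` ?E S l"
    proof (intro equalityI subsetI)
      fix A assume A: "A \<in> ?E (insert i S) k"
      show "A \<in> ?E S k \<union> insert i ` ?E S l"
      proof (cases "i \<in> A")
        case True
        then have "A - {i} \<in> ?E S l" "A = insert i (A - {i})" using A Suc by auto
        then show ?thesis by blast
      qed (use A in auto)
    next
      fix A assume "A \<in> ?E S k \<union> insert i ` ?E S l"
      then show "A \<in> ?E (insert i S) k"
        using insert.hyps Suc fin by (auto simp: card_insert_if)
    qed
    have "inj_on (insert i) (?E S l)"
      using insert.hyps by (auto simp: inj_on_def)
    then have "(\<Sum>A\<in>insert i ` ?E S l. \<Prod>i\<in>A. x i) = (\<Sum>A\<in>?E S l. \<Prod>i\<in>insert i A. x i)"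
      by (simp add: sum.reindex)
    also have "\<dots> = (\<Sum>A\<in>?E S l. x i * (\<Prod>i\<in>A. x i))"
      by (rule sum.cong) (use insert.hyps fin in \<open>auto intro!: prod.insert\<close>)
    also have "\<dots> = x i * ?c S l" by (simp add: sum_distrib_left)
    finally have *: "(\<Sum>A\<in>insert i ` ?E S l. \<Prod>i\<in>A. x i) = x i * ?c S l" .
    have "finite (?E S k)" "finite (?E S l)" using insert.hyps by auto
    moreover have "?E S k \<inter> insert i ` ?E S l = {}" using insert.hyps by auto
    ultimately have "?c (insert i S) k = ?c S k + (\<Sum>A\<in>insert i ` ?E S l. \<Prod>i\<in>A. x i)"
      unfolding split by (intro sum.union_disjoint) auto
    then show ?thesis using lhs Suc * by simp
  qed
qed

text \<open>The logarithmic derivative of \<open>\<Prod>(1 + x\<^sub>i z)\<close> is the alternating series of power sums. Writing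
  it with a product on the right avoids dividing in the ring of coefficients.\<close>

lemma fps_deriv_prod_one_plus_X:
  fixes x :: "'i \<Rightarrow> 'r::comm_ring_1"
  assumes "finite S"
  shows "fps_deriv (\<Prod>i\<in>S. 1 + fps_const (x i) * fps_X)
    = (\<Prod>i\<in>S. 1 + fps_const (x i) * fps_X) * Abs_fps (\<lambda>k. (- 1) ^ k * (\<Sum>i\<in>S. x i ^ Suc k))"
  using assms
proof (induction S)
  case empty
  then show ?case by (simp add: fps_eq_iff)
next
  case (insert i S)
  let ?G = "\<lambda>S. Abs_fps (\<lambda>k. (- 1) ^ k * (\<Sum>i\<in>S. x i ^ Suc k))"
  let ?P = "\<Prod>i\<in>S. 1 + fps_const (x i) * fps_X"
  let ?l = "1 + fps_const (x i) * fps_X"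
  have G: "?G (insert i S) = ?G S + Abs_fps (\<lambda>k. (- 1) ^ k * x i ^ Suc k)"
    using insert.hyps by (simp add: fps_eq_iff algebra_simps)
  have "(?l * Abs_fps (\<lambda>k. (- 1) ^ k * x i ^ Suc k)) $ m = fps_const (x i) $ m" for m
    by (cases m) (simp_all add: distrib_right mult.assoc)
  then have l: "?l * Abs_fps (\<lambda>k. (- 1) ^ k * x i ^ Suc k) = fps_const (x i)"
    by (simp add: fps_eq_iff)
  have "fps_deriv (\<Prod>i\<in>insert i S. 1 + fps_const (x i) * fps_X)
      = ?l * fps_deriv ?P + fps_const (x i) * ?P"
    using insert.hyps by simp
  also have "\<dots> = ?l * ?P * ?G S + (?l * Abs_fps (\<lambda>k. (- 1) ^ k * x i ^ Suc k)) * ?P"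
    unfolding l insert.IH by (simp add: algebra_simps)
  also have "\<dots> = ?l * ?P * ?G (insert i S)"
    unfolding G by (simp add: algebra_simps)
  finally show ?case using insert.hyps by simp
qed

text \<open>Newton's identities, read off from the \<open>n\<close>-th coefficients of the preceding lemma.\<close>

lemma newton_esym:
  "of_nat (Suc n) * esym (Suc n) N = (\<Sum>i\<le>n. esym i N * ((- 1) ^ (n - i) * psum (Suc (n - i)) N))"
proof -
  let ?P = "\<Prod>i\<in>{1..N}. 1 + fps_const (Var i :: (nat, rat) mpoly) * fps_X"
  have E: "?P $ k = esym k N" for k
    unfolding esym_def by (rule prod_one_plus_X_nth) simp
  have "fps_deriv ?P $ n = (?P * Abs_fps (\<lambda>k. (- 1) ^ k * (\<Sum>i\<in>{1..N}. Var i ^ Suc k))) $ n"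
    by (subst fps_deriv_prod_one_plus_X) simp_all
  then show ?thesis
    unfolding fps_deriv_nth fps_mult_nth E psum_def
    by (simp add: atLeast0AtMost del: power_Suc)
qed

lemma vars_add: "vars (p + p') \<subseteq> vars p \<union> vars p'"
  using keys_add[of p p'] by (auto simp: vars_def)

lemma vars_mult:
  fixes p p' :: "('v, 'a::comm_ring_1) mpoly"
  shows "vars (p * p') \<subseteq> vars p \<union> vars p'"
proof
  fix v assume "v \<in> vars (p * p')"
  then obtain m where m: "m \<in> Poly_Mapping.keys (p * p')" "v \<in> Poly_Mapping.keys m"
    by (auto simp: vars_def)
  then obtain a b where "m = a + b" "a \<in> Poly_Mapping.keys p" "b \<in> Poly_Mapping.keys p'"
    using keys_mult[of p p'] by auto
  then show "v \<in> vars p \<union> vars p'"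
    using m(2) keys_add[of a b] by (auto simp: vars_def)
qed

lemma vars_sum: "vars (\<Sum>i\<in>A. p i) \<subseteq> (\<Union>i\<in>A. vars (p i))"
proof (induction A rule: infinite_finite_induct)
  case (insert i A)
  then show ?case using vars_add[of "p i" "sum p A"] by auto
qed (simp_all add: vars_def)

lemma vars_Const [simp]: "vars (Const c) = {}"
  by (simp add: vars_def Const_def)

lemma vars_Var [simp]: "vars (Var v :: ('v, 'a::zero_neq_one) mpoly) = {v}"
  by (simp add: vars_def Var_def)

text \<open>Newton's identities can be solved for \<open>e\<^sub>n\<close> because \<open>n\<close> is invertible. The power sum \<open>p\<^sub>0\<close> has to
  be excluded: its value \<open>N\<close> depends on the number of variables, and the plethystic substitution
  for it would divide by \<open>0\<close>.\<close>

lemma esym_in_psums: "\<exists>P. 0 \<notin> vars P \<and> (\<forall>N. subst Const (\<lambda>k. psum k N) P = esym n N)"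
proof (induction n rule: less_induct)
  case (less n)
  interpret Const: comm_ring_hom "Const :: rat \<Rightarrow> (nat, rat) mpoly" by (rule comm_ring_hom_Const)
  show ?case
  proof (cases n)
    case 0
    have "{A. A \<subseteq> {1..N::nat} \<and> card A = 0} = {{}}" for N
      using finite_subset[of _ "{1..N}"] by auto
    then have "esym n N = 1" for N by (simp add: 0 esym_def)
    then show ?thesis
      using Const.subst_one by (intro exI[of _ 1]) (auto simp: vars_def)
  next
    case (Suc k)
    obtain P where P: "0 \<notin> vars (P i)" "subst Const (\<lambda>k. psum k N) (P i) = esym i N"
      if "i \<le> k" for i N
      using less.IH Suc by (metis less_Suc_eq_le)
    define Q where "Q = Const (1 / of_nat (Suc k))
      * (\<Sum>i\<le>k. P i * (Const ((- 1) ^ (k - i)) * Var (Suc (k - i))))"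
    have "vars Q \<subseteq> (\<Union>i\<le>k. vars (P i) \<union> {Suc (k - i)})"
    proof
      fix v assume "v \<in> vars Q"
      then have "v \<in> vars (\<Sum>i\<le>k. P i * (Const ((- 1) ^ (k - i)) * Var (Suc (k - i))))"
        using vars_mult unfolding Q_def by fastforce
      then obtain i where "i \<le> k" "v \<in> vars (P i * (Const ((- 1) ^ (k - i)) * Var (Suc (k - i))))"
        using vars_sum by fastforce
      moreover have "vars (P i * (Const ((- 1) ^ (k - i)) * Var (Suc (k - i)))) \<subseteq> vars (P i) \<union> {Suc (k - i)}"
        using vars_mult[of "P i"] vars_mult[of "Const ((- 1) ^ (k - i)) :: (nat, rat) mpoly" "Var (Suc (k - i))"]
        by auto
      ultimately show "v \<in> (\<Union>i\<le>k. vars (P i) \<union> {Suc (k - i)})" by blast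
    qed
    then have "0 \<notin> vars Q" using P(1) by auto
    moreover have "subst Const (\<lambda>k. psum k N) Q = esym n N" for N
    proof -
      have "subst Const (\<lambda>k. psum k N) Q = Const (1 / of_nat (Suc k))
          * (\<Sum>i\<le>k. esym i N * (Const ((- 1) ^ (k - i)) * psum (Suc (k - i)) N))"
        by (simp add: Q_def Const.subst_mult Const.subst_sum Const.subst_Const Const.subst_Var P(2))
      also have "\<dots> = Const (1 / of_nat (Suc k)) * (of_nat (Suc k) * esym (Suc k) N)"
        unfolding newton_esym by (simp only: Const.hom_power Const.hom_uminus Const.hom_one)
      also have "of_nat (Suc k) = (Const (of_nat (Suc k)) :: (nat, rat) mpoly)"
        by (simp only: Const.hom_of_nat)
      also have "Const (1 / of_nat (Suc k)) * (Const (of_nat (Suc k)) * esym (Suc k) N)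
          = Const (1 / of_nat (Suc k) * of_nat (Suc k)) * esym (Suc k) N"
        by (simp only: Const.hom_mult mult.assoc)
      also have "\<dots> = esym n N"
        by (simp add: Suc del: of_nat_Suc)
      finally show ?thesis .
    qed
    ultimately show ?thesis by blast
  qed
qed

lemma e_in_p: "0 \<notin> vars (e_in_p n)" "subst Const (\<lambda>k. psum k N) (e_in_p n) = esym n N"
  using someI_ex[OF esym_in_psums[of n]] unfolding e_in_p_def by auto

section \<open>Plethysm as a sum over sets of cells\<close>

definition cells :: "(nat \<times> nat) set" where
  "cells = {(a, b). odd (a + b)}"

definition cell_sets :: "nat \<Rightarrow> (nat \<times> nat) set set" where
  "cell_sets n = {S. S \<subseteq> cells \<and> finite S \<and> card S = n}"

lemma qt_monom_eq_power:
  "qt_monom (k, 0) = q_fps ^ k" "qt_monom (0, k) = t_fps ^ k"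
  by (simp_all add: qt_monom_def)

text \<open>A cell is one of the corners \<open>(1, 0), (0, 1)\<close> plus a pair of even numbers, which gives the
  numerator and the two geometric series.\<close>

lemma gf_cells:
  assumes "k \<ge> 1"
  shows "gf cells (scale_weight k)
    = (q_fps ^ k + t_fps ^ k) / ((1 - (q_fps ^ k)\<^sup>2) * (1 - (t_fps ^ k)\<^sup>2))"
proof -
  let ?U = "UNIV :: nat set"
  let ?wq = "\<lambda>i. scale_weight i (2 * k, 0)" and ?wt = "\<lambda>j. scale_weight j (0, 2 * k)"
  let ?corners = "{(1, 0), (0, 1)} :: (nat \<times> nat) set"
  let ?h = "\<lambda>((a, b), i, j). (a + 2 * i, b + 2 * j)"
  let ?w = "\<lambda>(i, j). ?wq i + ?wt j"
  have nz: "(2 * k, 0) \<noteq> (0, 0)" "(0, 2 * k) \<noteq> (0, 0)" using assms by auto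
  note fin = finite_fibres_multiples[OF nz(1)] finite_fibres_multiples[OF nz(2)]
  have "bij_betw ?h (?corners \<times> ?U \<times> ?U) cells"
  proof (rule bij_betwI[where g = "\<lambda>(a, b). ((a mod 2, b mod 2), a div 2, b div 2)"])
    show "(\<lambda>(a, b). ((a mod 2, b mod 2), a div 2, b div 2)) \<in> cells \<rightarrow> ?corners \<times> ?U \<times> ?U"
      by (auto simp: cells_def) presburger+
  qed (auto simp: cells_def mod_2_eq_odd odd_pos)
  then have "gf (?corners \<times> ?U \<times> ?U) (\<lambda>(c, ij). scale_weight k c + ?w ij) = gf cells (scale_weight k)"
    by (rule gf_bij) (auto simp: scale_weight_def)
  also have "gf (?corners \<times> ?U \<times> ?U) (\<lambda>(c, ij). scale_weight k c + ?w ij)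
      = gf ?corners (scale_weight k) * gf (?U \<times> ?U) ?w"
    by (rule gf_Times) (simp, rule finite_fibres_Times[OF fin])
  also have "gf (?U \<times> ?U) ?w = gf ?U ?wq * gf ?U ?wt" by (rule gf_Times[OF fin])
  also have "gf ?corners (scale_weight k) = q_fps ^ k + t_fps ^ k"
    by (simp add: gf_finite scale_weight_def qt_monom_eq_power)
  finally have eq: "gf cells (scale_weight k) = (q_fps ^ k + t_fps ^ k) * (gf ?U ?wq * gf ?U ?wt)" ..
  have sq: "(q_fps ^ k)\<^sup>2 = qt_monom (2 * k, 0)" "(t_fps ^ k)\<^sup>2 = qt_monom (0, 2 * k)"
    by (simp_all add: qt_monom_eq_power mult.commute flip: power_mult)
  have unit: "(1 - qt_monom c) $ 0 $ 0 \<noteq> 0" if "c \<noteq> (0, 0)" for c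
    using that by (auto simp: qt_monom_nth)
  have "gf ?U ?wq * (1 - qt_monom (2 * k, 0)) = 1" "gf ?U ?wt * (1 - qt_monom (0, 2 * k)) = 1"
    unfolding gf_multiples[OF nz(1)] gf_multiples[OF nz(2)]
    by (rule fps_fps_divide_mult, rule unit, rule nz)+
  then have "(gf ?U ?wq * (1 - qt_monom (2 * k, 0))) * (gf ?U ?wt * (1 - qt_monom (0, 2 * k))) = 1"
    by simp
  then have "gf ?U ?wq * gf ?U ?wt * ((1 - qt_monom (2 * k, 0)) * (1 - qt_monom (0, 2 * k))) = 1"
    by (simp only: mult.assoc mult.left_commute)
  then show ?thesis unfolding eq sq
    by (intro fps_fps_divide_eqI[symmetric]) (use unit nz in \<open>simp_all add: mult.assoc\<close>)
qed

lemma pleth_e_cells: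
  "pleth_e n (\<lambda>q t. (q + t) / ((1 - q\<^sup>2) * (1 - t\<^sup>2))) = gf (cell_sets n) (\<lambda>S. \<Sum>c\<in>S. c)"
proof -
  let ?\<iota> = "\<lambda>c::rat. fps_const (fps_const c)"
  let ?W = "\<lambda>k. (q_fps ^ k + t_fps ^ k) / ((1 - (q_fps ^ k)\<^sup>2) * (1 - (t_fps ^ k)\<^sup>2))"
  let ?G = "gf (cell_sets n) (\<lambda>S. \<Sum>c\<in>S. c)"
  interpret \<iota>: comm_ring_hom ?\<iota>
    by unfold_locales simp_all
  have "agree_upto d (subst ?\<iota> ?W (e_in_p n)) ?G" for d
  proof -
    \<comment> \<open>Up to bidegree \<open>(d, d)\<close> only the monomials of these finitely many cells contribute.\<close>
    define C where "C = cells \<inter> {0..d} \<times> {0..d}"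
    define N where "N = card C"
    have finC: "finite C" by (simp add: C_def)
    then obtain h where h: "bij_betw h {1..N} C"
      unfolding N_def using ex_bij_betw_nat_finite_1 by blast
    define x where "x i = qt_monom (h i)" for i
    have W: "agree_upto d (?W k) (subst ?\<iota> x (psum k N))" if "k \<in> vars (e_in_p n)" for k
    proof -
      have k: "k \<ge> 1" using that e_in_p(1)[of n] by (cases k) auto
      \<comment> \<open>With \<open>k = 0\<close> all cells would have weight \<open>(0, 0)\<close> and no truncation would be finite.\<close>
      have le: "a \<le> k * a" for a :: nat using k by simp
      have "agree_upto d (?W k) (\<Sum>c\<in>C. qt_monom (scale_weight k c))"
        unfolding gf_cells[OF k, symmetric]
      proof (rule gf_truncate)
        fix c assume "c \<in> cells" "fst (scale_weight k c) \<le> d" "snd (scale_weight k c) \<le> d"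
        then show "c \<in> C"
          using order.trans[OF le, of "fst c" d] order.trans[OF le, of "snd c" d]
          by (cases c) (simp add: C_def scale_weight_def)
      qed (use finC in \<open>auto simp: C_def\<close>)
      also have "(\<Sum>c\<in>C. qt_monom (scale_weight k c)) = (\<Sum>i\<in>{1..N}. x i ^ k)"
        using sum.reindex_bij_betw[OF h, of "\<lambda>c. qt_monom c ^ k"]
        by (simp add: x_def qt_monom_scale)
      finally show ?thesis
        by (simp add: psum_def \<iota>.subst_sum \<iota>.subst_power \<iota>.subst_Var)
    qed
    have "agree_upto d (subst ?\<iota> ?W (e_in_p n)) (subst ?\<iota> (\<lambda>k. subst ?\<iota> x (psum k N)) (e_in_p n))"
      unfolding subst_def[of ?\<iota> _ "e_in_p n"]
      by (intro agree_upto_sum agree_upto_mult agree_upto_prod agree_upto_power W agree_upto_refl)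
        (auto simp: vars_def)
    also have "subst ?\<iota> (\<lambda>k. subst ?\<iota> x (psum k N)) (e_in_p n) = subst ?\<iota> x (esym n N)"
      by (simp only: \<iota>.subst_subst[symmetric] e_in_p(2))
    also have "\<dots> = (\<Sum>A\<in>{A. A \<subseteq> {1..N} \<and> card A = n}. \<Prod>i\<in>A. x i)"
      by (simp add: esym_def \<iota>.subst_sum \<iota>.subst_prod \<iota>.subst_Var)
    also have "\<dots> = (\<Sum>A\<in>{A. A \<subseteq> {1..N} \<and> card A = n}. qt_monom (\<Sum>c\<in>h ` A. c))"
    proof (rule sum.cong)
      fix A assume "A \<in> {A. A \<subseteq> {1..N} \<and> card A = n}"
      then have "inj_on h A" using h by (auto simp: bij_betw_def inj_on_subset)
      then show "(\<Prod>i\<in>A. x i) = qt_monom (\<Sum>c\<in>h ` A. c)"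
        by (simp add: sum.reindex qt_monom_sum x_def)
    qed simp
    also have "\<dots> = (\<Sum>S\<in>{S. S \<subseteq> C \<and> card S = n}. qt_monom (\<Sum>c\<in>S. c))"
    proof (rule sum.reindex_bij_betw)
      show "bij_betw (image h) {A. A \<subseteq> {1..N} \<and> card A = n} {S. S \<subseteq> C \<and> card S = n}"
        unfolding bij_betw_def
      proof
        show "inj_on (image h) {A. A \<subseteq> {1..N} \<and> card A = n}"
          by (rule inj_on_subset[OF inj_on_image_Pow]) (use h in \<open>auto simp: bij_betw_def\<close>)
        have img: "card (h ` A) = card A" if "A \<subseteq> {1..N}" for A
          using h that by (meson bij_betw_def card_image inj_on_subset)
        show "image h ` {A. A \<subseteq> {1..N} \<and> card A = n} = {S. S \<subseteq> C \<and> card S = n}"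
        proof (intro equalityI subsetI)
          fix S assume S: "S \<in> {S. S \<subseteq> C \<and> card S = n}"
          then obtain A where "A \<subseteq> {1..N}" "S = h ` A"
            using h by (auto simp: bij_betw_def subset_image_iff)
          then show "S \<in> image h ` {A. A \<subseteq> {1..N} \<and> card A = n}" using S img by auto
        qed (use h img in \<open>auto simp: bij_betw_def\<close>)
      qed
    qed
    also have "agree_upto d \<dots> ?G"
    proof (rule agree_upto_sym[OF gf_truncate])
      show "finite {S. S \<subseteq> C \<and> card S = n}" using finC by auto
      show "{S. S \<subseteq> C \<and> card S = n} \<subseteq> cell_sets n"
        using finC by (auto simp: C_def cell_sets_def intro: finite_subset)
      fix S :: "(nat \<times> nat) set"
      assume S: "S \<in> cell_sets n" "fst (\<Sum>c\<in>S. c) \<le> d" "snd (\<Sum>c\<in>S. c) \<le> d"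
      have "fst c \<le> d \<and> snd c \<le> d" if "c \<in> S" for c
        using S that member_le_sum[of c S fst] member_le_sum[of c S snd]
        by (auto simp: fst_sum snd_sum cell_sets_def)
      then show "S \<in> {S. S \<subseteq> C \<and> card S = n}"
        using S by (force simp: C_def cell_sets_def)
    qed
    finally show ?thesis .
  qed
  then have "subst ?\<iota> ?W (e_in_p n) = ?G"
    by (intro fps_fps_eqI) (meson agree_upto_def max.cobounded1 max.cobounded2)
  then show ?thesis by (simp add: pleth_e_def)
qed

section \<open>Decreasing sequences with prescribed parities\<close>

text \<open>The shape of the coordinate sequences of a listed set of cells: \<open>T\<close> consists of the positions
  where the rule for breaking ties is satisfied.\<close>

definition parity_seqs :: "nat \<Rightarrow> (nat \<Rightarrow> bool) \<Rightarrow> nat set \<Rightarrow> (nat \<Rightarrow> nat) set" where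
  "parity_seqs n s T = {a \<in> {1..n} \<rightarrow>\<^sub>E UNIV. (\<forall>i\<in>{1..n}. odd (a i) \<longleftrightarrow> s i) \<and>
     (\<forall>i\<in>{1..<n}. a (i + 1) < a i \<or> a (i + 1) = a i \<and> i \<in> T)}"

text \<open>The positions where the quotients \<open>a\<^sub>i div 2\<close> must decrease strictly.\<close>

definition forced_gaps :: "nat \<Rightarrow> (nat \<Rightarrow> bool) \<Rightarrow> nat set \<Rightarrow> nat set" where
  "forced_gaps n s T = {i\<in>{1..<n}. \<not> s i \<and> s (i + 1) \<or> s i = s (i + 1) \<and> i \<notin> T}"

lemma sum_tails: "(\<Sum>i\<in>{1..n}. \<Sum>k\<in>{i..n}. x k) = (\<Sum>k\<in>{1..n}. k * (x k :: nat))"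
proof (induction n)
  case (Suc n)
  have "(\<Sum>i\<in>{1..n}. \<Sum>k\<in>{i..Suc n}. x k) = (\<Sum>i\<in>{1..n}. (\<Sum>k\<in>{i..n}. x k) + x (Suc n))"
    by (rule sum.cong) auto
  then show ?case using Suc by (simp add: sum.distrib)
qed simp

text \<open>In terms of the quotients by \<open>2\<close> the parities disappear and only the forced gaps remain.\<close>

lemma parity_seqs_iff:
  "a \<in> parity_seqs n s T \<longleftrightarrow> a \<in> {1..n} \<rightarrow>\<^sub>E UNIV \<and> (\<forall>i\<in>{1..n}. a i mod 2 = of_bool (s i)) \<and>
     (\<forall>i\<in>{1..<n}. a (i + 1) div 2 + of_bool (i \<in> forced_gaps n s T) \<le> a i div 2)"
proof -
  have par: "a i mod 2 = of_bool (s i) \<longleftrightarrow> (odd (a i) \<longleftrightarrow> s i)" for i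
    by (cases "s i") (auto simp: mod_2_eq_odd)
  have gap: "(a (i + 1) < a i \<or> a (i + 1) = a i \<and> i \<in> T)
      \<longleftrightarrow> a (i + 1) div 2 + of_bool (i \<in> forced_gaps n s T) \<le> a i div 2"
    if "\<forall>i\<in>{1..n}. odd (a i) \<longleftrightarrow> s i" "i \<in> {1..<n}" for i
  proof -
    have "a i mod 2 = of_bool (s i)" "a (i + 1) mod 2 = of_bool (s (i + 1))"
      using that by (simp_all add: par)
    then have "a i = 2 * (a i div 2) + of_bool (s i)"
      "a (i + 1) = 2 * (a (i + 1) div 2) + of_bool (s (i + 1))"
      using mult_div_mod_eq[of 2 "a i"] mult_div_mod_eq[of 2 "a (i + 1)"] by simp_all
    moreover have "of_bool (i \<in> forced_gaps n s T)
        = (of_bool (\<not> s i \<and> s (i + 1) \<or> s i = s (i + 1) \<and> i \<notin> T) :: nat)"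
      using that(2) by (simp add: forced_gaps_def)
    ultimately show ?thesis
      by (cases "s i"; cases "s (i + 1)"; cases "i \<in> T") (simp_all, linarith+)
  qed
  show ?thesis unfolding parity_seqs_def mem_Collect_eq par
    by (intro conj_cong refl ball_cong) (use gap in blast)
qed

text \<open>The quotients \<open>a\<^sub>i div 2\<close> are recovered from the right by summing their consecutive differences, and
  subtracting the forced part of each difference leaves an arbitrary natural number. The last
  difference is the last quotient itself, with \<open>0\<close> in place of an entry \<open>n + 1\<close>.\<close>

lemma parity_seqs_bij:
  defines "e \<equiv> \<lambda>s T n k. of_bool (k \<in> forced_gaps n s T) :: nat"
  shows "bij_betw (\<lambda>m. \<lambda>i\<in>{1..n}. of_bool (s i) + 2 * (\<Sum>k\<in>{i..n}. m k + e s T n k))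
    ({1..n} \<rightarrow>\<^sub>E UNIV) (parity_seqs n s T)"
proof (rule bij_betwI[where g = "\<lambda>a. \<lambda>i\<in>{1..n}.
    a i div 2 - (if i < n then a (i + 1) div 2 + e s T n i else 0)"])
  let ?e = "e s T n"
  let ?f = "\<lambda>m. \<lambda>i\<in>{1..n}. of_bool (s i) + 2 * (\<Sum>k\<in>{i..n}. m k + ?e k)"
  let ?g = "\<lambda>a. \<lambda>i\<in>{1..n}. a i div 2 - (if i < n then a (i + 1) div 2 + ?e i else 0)"
  have en: "?e n = 0" by (simp add: e_def forced_gaps_def)
  have half: "?f m i div 2 = (\<Sum>k\<in>{i..n}. m k + ?e k)" if "i \<in> {1..n}" for m i
    using that by simp
  have tail: "(\<Sum>k\<in>{i..n}. x k) = x i + (\<Sum>k\<in>{i + 1..n}. x k)" if "i \<in> {1..n}" for x :: "nat \<Rightarrow> nat" and i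
    using that by (simp add: sum.atLeast_Suc_atMost)
  show "?f \<in> ({1..n} \<rightarrow>\<^sub>E UNIV) \<rightarrow> parity_seqs n s T"
  proof
    fix m :: "nat \<Rightarrow> nat"
    have "?f m (i + 1) div 2 + ?e i \<le> ?f m i div 2" if "i \<in> {1..<n}" for i
    proof -
      have "i + 1 \<in> {1..n}" "i \<in> {1..n}" using that by auto
      then show ?thesis
        unfolding half[OF \<open>i + 1 \<in> {1..n}\<close>] half[OF \<open>i \<in> {1..n}\<close>] tail[OF \<open>i \<in> {1..n}\<close>] by simp
    qed
    moreover have "?f m i mod 2 = of_bool (s i)" if "i \<in> {1..n}" for i
      using that by simp
    ultimately show "?f m \<in> parity_seqs n s T"
      unfolding parity_seqs_iff e_def by auto
  qed
  show "?g \<in> parity_seqs n s T \<rightarrow> ({1..n} \<rightarrow>\<^sub>E UNIV)" by auto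
  show "?g (?f m) = m" if m: "m \<in> {1..n} \<rightarrow>\<^sub>E UNIV" for m
  proof (rule PiE_ext[OF _ m])
    fix i assume i: "i \<in> {1..n}"
    show "?g (?f m) i = m i"
    proof (cases "i < n")
      case True
      then have "i + 1 \<in> {1..n}" by simp
      then have "?g (?f m) i = (\<Sum>k\<in>{i..n}. m k + ?e k) - ((\<Sum>k\<in>{i + 1..n}. m k + ?e k) + ?e i)"
        using half[OF i, of m] half[of "i + 1" m] i True by simp
      then show ?thesis using tail[OF i, of "\<lambda>k. m k + ?e k"] by simp
    next
      case False
      then have "i = n" using i by simp
      then show ?thesis using half[OF i, of m] i en by simp
    qed
  qed auto
  show "?f (?g a) = a" if a: "a \<in> parity_seqs n s T" for a
  proof (rule PiE_ext)
    show "a \<in> {1..n} \<rightarrow>\<^sub>E UNIV" using a by (simp add: parity_seqs_def)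
    fix i assume i: "i \<in> {1..n}"
    have "(\<Sum>k\<in>{n - l..n}. ?g a k + ?e k) = a (n - l) div 2" if "n - l \<in> {1..n}" for l
      using that
    proof (induction l)
      case 0
      then show ?case using en by simp
    next
      case (Suc l)
      then have l: "n - l = n - Suc l + 1" "n - l \<in> {1..n}" "n - Suc l \<in> {1..<n}" by auto
      have ge: "a (n - l) div 2 + ?e (n - Suc l) \<le> a (n - Suc l) div 2"
        using a l(3) unfolding parity_seqs_iff e_def l(1) by blast
      have "(\<Sum>k\<in>{n - Suc l..n}. ?g a k + ?e k) = ?g a (n - Suc l) + ?e (n - Suc l) + a (n - l) div 2"
        using tail[OF Suc.prems, of "\<lambda>k. ?g a k + ?e k"] Suc.IH[OF l(2)] unfolding l(1) by simp
      also have "?g a (n - Suc l) = a (n - Suc l) div 2 - (a (n - l) div 2 + ?e (n - Suc l))"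
        using l by simp
      finally show ?case using ge by simp
    qed
    from this[of "n - i"] have "(\<Sum>k\<in>{i..n}. ?g a k + ?e k) = a i div 2" using i by simp
    then have "?f (?g a) i = of_bool (s i) + 2 * (a i div 2)" using i by simp
    also have "\<dots> = a i" using a i unfolding parity_seqs_iff by (metis mod_mult_div_eq)
    finally show "?f (?g a) i = a i" .
  qed auto
qed

text \<open>The free part of the difference at position \<open>i\<close> raises \<open>i\<close> entries by \<open>2\<close>, hence the geometric
  series at \<open>i\<close>; the forced parts and the parities give the monomial in front. The vector
  \<open>c\<close> selects the variable in which the sum is recorded.\<close>

lemma
  assumes c: "c \<noteq> (0, 0)"
  shows gf_parity_seqs: "gf (parity_seqs n s T) (\<lambda>a. scale_weight (\<Sum>i\<in>{1..n}. a i) c)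
      = qt_monom (scale_weight (2 * (\<Sum>i\<in>forced_gaps n s T. i) + card {i\<in>{1..n}. s i}) c)
        * (\<Prod>i=1..n. 1 / (1 - qt_monom c ^ (2 * i)))" (is ?gf)
    and finite_fibres_parity_seqs:
      "finite_fibres (parity_seqs n s T) (\<lambda>a. scale_weight (\<Sum>i\<in>{1..n}. a i) c)" (is ?fin)
proof -
  let ?e = "\<lambda>k. of_bool (k \<in> forced_gaps n s T) :: nat"
  let ?f = "\<lambda>m. \<lambda>i\<in>{1..n}. of_bool (s i) + 2 * (\<Sum>k\<in>{i..n}. m k + ?e k)"
  let ?c0 = "scale_weight (2 * (\<Sum>i\<in>forced_gaps n s T. i) + card {i\<in>{1..n}. s i}) c"
  let ?w = "\<lambda>i k. scale_weight k (scale_weight (2 * i) c)"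
  have bij: "bij_betw ?f ({1..n} \<rightarrow>\<^sub>E UNIV) (parity_seqs n s T)"
    by (rule parity_seqs_bij)
  have w: "scale_weight (\<Sum>i\<in>{1..n}. ?f m i) c = ?c0 + (\<Sum>i\<in>{1..n}. ?w i (m i))" for m
  proof -
    have gaps: "(\<Sum>k\<in>{1..n}. k * ?e k) = (\<Sum>i\<in>forced_gaps n s T. i)"
    proof -
      have "forced_gaps n s T \<subseteq> {1..n}" by (auto simp: forced_gaps_def)
      then show ?thesis by (simp add: of_bool_def if_distrib sum.If_cases Int_absorb1)
    qed
    have "(\<Sum>i\<in>{1..n}. ?f m i) = (\<Sum>i\<in>{1..n}. of_bool (s i)) + 2 * (\<Sum>i\<in>{1..n}. \<Sum>k\<in>{i..n}. m k + ?e k)"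
      by (simp add: sum.distrib sum_distrib_left)
    also have "(\<Sum>i\<in>{1..n}. \<Sum>k\<in>{i..n}. m k + ?e k) = (\<Sum>k\<in>{1..n}. k * m k) + (\<Sum>i\<in>forced_gaps n s T. i)"
      unfolding sum_tails distrib_left sum.distrib gaps ..
    also have "(\<Sum>i\<in>{1..n}. of_bool (s i)) = card {i\<in>{1..n}. s i}"
      by (simp add: of_bool_def sum.If_cases Int_def)
    finally show ?thesis
      by (simp add: scale_weight_def prod_eq_iff fst_sum snd_sum algebra_simps sum_distrib_left)
  qed
  have nz: "scale_weight (2 * i) c \<noteq> (0, 0)" if "i \<in> {1..n}" for i
    using that c by (cases c) (auto simp: scale_weight_def)
  have fin: "finite_fibres ({1..n} \<rightarrow>\<^sub>E UNIV) (\<lambda>m. \<Sum>i\<in>{1..n}. ?w i (m i))"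
    by (rule finite_fibres_PiE) (simp, rule finite_fibres_multiples[OF nz])
  show ?fin
    using finite_fibres_bij[where w' = "\<lambda>a. scale_weight (\<Sum>i\<in>{1..n}. a i) c",
        OF bij w finite_fibres_shift[OF fin]] .
  have "gf (parity_seqs n s T) (\<lambda>a. scale_weight (\<Sum>i\<in>{1..n}. a i) c)
      = gf ({1..n} \<rightarrow>\<^sub>E UNIV) (\<lambda>m. ?c0 + (\<Sum>i\<in>{1..n}. ?w i (m i)))"
    using gf_bij[where w' = "\<lambda>a. scale_weight (\<Sum>i\<in>{1..n}. a i) c", OF bij w] ..
  also have "\<dots> = qt_monom ?c0 * (\<Prod>i\<in>{1..n}. gf UNIV (?w i))"
    unfolding gf_shift[OF fin]
    by (subst gf_PiE[where w = ?w]) (simp, rule finite_fibres_multiples[OF nz], simp_all)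
  also have "(\<Prod>i\<in>{1..n}. gf UNIV (?w i)) = (\<Prod>i=1..n. 1 / (1 - qt_monom c ^ (2 * i)))"
    by (rule prod.cong) (simp_all add: gf_multiples[OF nz] qt_monom_scale)
  finally show ?gf .
qed

text \<open>The order \<open>\<prec>\<^sub>s\<close> puts negative values first and compares absolute values within a sign. This is
  exactly what is needed for the forced gaps to be descents when negative values mark odd entries
  and ties follow increasing absolute values, and ascents when both conventions are reversed.\<close>

lemma
  assumes inj: "inj_on (\<lambda>i. \<bar>\<delta> (int i)\<bar>) {1..n}" and nz: "\<And>i. i \<in> {1..n} \<Longrightarrow> \<delta> (int i) \<noteq> 0"
  shows forced_gaps_Des:
      "forced_gaps n (\<lambda>i. \<delta> (int i) < 0) {i. \<bar>\<delta> (int i)\<bar> < \<bar>\<delta> (int (i + 1))\<bar>} = Des n \<delta>"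
    and forced_gaps_Asc:
      "forced_gaps n (\<lambda>i. \<delta> (int i) > 0) {i. \<bar>\<delta> (int (i + 1))\<bar> < \<bar>\<delta> (int i)\<bar>} = {1..<n} - Des n \<delta>"
proof -
  have range: "{1..n - 1} = {1..<n}" by auto
  have sprec: "b \<prec>\<^sub>s a \<longleftrightarrow> \<not> a < 0 \<and> b < 0 \<or> (a < 0) = (b < 0) \<and> \<not> \<bar>a\<bar> < \<bar>b\<bar>"
    "\<not> b \<prec>\<^sub>s a \<longleftrightarrow> \<not> a > 0 \<and> b > 0 \<or> (a > 0) = (b > 0) \<and> \<not> \<bar>b\<bar> < \<bar>a\<bar>"
    if "\<bar>a\<bar> \<noteq> \<bar>b\<bar> \<and> a \<noteq> 0 \<and> b \<noteq> 0" for a b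
    using that by (cases "a < 0"; cases "b < 0"; auto simp: sprec_def)+
  have "\<bar>\<delta> (int i)\<bar> \<noteq> \<bar>\<delta> (int (i + 1))\<bar> \<and> \<delta> (int i) \<noteq> 0 \<and> \<delta> (int (i + 1)) \<noteq> 0" if "i \<in> {1..<n}" for i
    using that inj_onD[OF inj, of i "i + 1"] nz[of i] nz[of "i + 1"] by auto
  from sprec[OF this] show "forced_gaps n (\<lambda>i. \<delta> (int i) < 0) {i. \<bar>\<delta> (int i)\<bar> < \<bar>\<delta> (int (i + 1))\<bar>} = Des n \<delta>"
    "forced_gaps n (\<lambda>i. \<delta> (int i) > 0) {i. \<bar>\<delta> (int (i + 1))\<bar> < \<bar>\<delta> (int i)\<bar>} = {1..<n} - Des n \<delta>"
    unfolding forced_gaps_def Des_def range by blast+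
qed

text \<open>Replacing descents by ascents and negative values by positive ones complements \<open>fmaj\<close> in
  \<open>2 (1 + \<dots> + (n - 1)) + n = n\<^sup>2\<close>, so the subtraction of natural numbers is exact.\<close>

lemma fmaj_complement:
  assumes nz: "\<And>i. i \<in> {1..n} \<Longrightarrow> \<delta> (int i) \<noteq> 0"
  shows "2 * (\<Sum>i\<in>{1..<n} - Des n \<delta>. i) + card {i\<in>{1..n}. \<delta> (int i) > 0} = n ^ 2 - fmaj n \<delta>"
proof -
  have D: "Des n \<delta> \<subseteq> {1..<n}" by (auto simp: Des_def)
  have "(\<Sum>i\<in>{1..<n}. i) = (\<Sum>i\<in>{1..<n} - Des n \<delta>. i) + (\<Sum>i\<in>Des n \<delta>. i)"
    by (rule sum.subset_diff[OF D]) simp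
  moreover have "2 * (\<Sum>i\<in>{1..<n}. i) + n = n ^ 2"
    by (induction n) (simp_all add: power2_eq_square)
  moreover have "card {i\<in>{1..n}. \<delta> (int i) > 0} + neg n \<delta> = n"
  proof -
    have "{1..n} = {i\<in>{1..n}. \<delta> (int i) > 0} \<union> {i\<in>{1..n}. \<delta> (int i) < 0}"
      using nz by force
    then have "n = card ({i\<in>{1..n}. \<delta> (int i) > 0} \<union> {i\<in>{1..n}. \<delta> (int i) < 0})"
      by (metis card_atLeastAtMost add_diff_cancel_right' Suc_eq_plus1)
    also have "\<dots> = card {i\<in>{1..n}. \<delta> (int i) > 0} + neg n \<delta>"
      unfolding neg_def by (rule card_Un_disjoint) auto
    finally show ?thesis ..
  qed
  ultimately show ?thesis unfolding fmaj_def maj_def by simp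
qed

section \<open>Ranks in finite total orders\<close>

text \<open>Ranks start at \<open>1\<close>, like the positions of signed permutations.\<close>

definition rank :: "('a \<Rightarrow> 'a \<Rightarrow> bool) \<Rightarrow> 'a set \<Rightarrow> 'a \<Rightarrow> nat" where
  "rank r S x = Suc (card {y\<in>S. r y x})"

lemma
  assumes fin: "finite S"
    and order: "asymp r" "transp r" "totalp r"
  shows rank_less_iff: "x \<in> S \<Longrightarrow> y \<in> S \<Longrightarrow> rank r S x < rank r S y \<longleftrightarrow> r x y"
    and rank_bij: "bij_betw (rank r S) S {1..card S}"
proof -
  have irrefl: "\<not> r x x" for x using asympD[OF order(1)] by blast
  have trans: "r x y \<Longrightarrow> r y z \<Longrightarrow> r x z" for x y z using transpD[OF order(2)] by blast
  have total: "x \<noteq> y \<Longrightarrow> r x y \<or> r y x" for x y using totalpD[OF order(3)] by blast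
  have less: "rank r S x < rank r S y" if "x \<in> S" "y \<in> S" "r x y" for x y
  proof -
    have "{z\<in>S. r z x} \<subset> {z\<in>S. r z y}" using that irrefl trans by blast
    then show ?thesis using fin by (simp add: rank_def psubset_card_mono)
  qed
  then show iff: "rank r S x < rank r S y \<longleftrightarrow> r x y" if "x \<in> S" "y \<in> S" for x y
    using that total by (metis less_asym irrefl)
  have inj: "inj_on (rank r S) S"
    using iff total by (intro inj_onI) (metis less_irrefl)
  have "rank r S ` S \<subseteq> {1..card S}"
  proof
    fix k assume "k \<in> rank r S ` S"
    then obtain x where x: "x \<in> S" "k = rank r S x" by auto
    then have "{y\<in>S. r y x} \<subset> S" using irrefl by blast
    then have "card {y\<in>S. r y x} < card S" using fin by (simp add: psubset_card_mono)
    then show "k \<in> {1..card S}" using x by (simp add: rank_def)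
  qed
  moreover have "card (rank r S ` S) = card {1..card S}" using inj by (simp add: card_image)
  ultimately show "bij_betw (rank r S) S {1..card S}"
    using inj by (simp add: bij_betw_def card_subset_eq)
qed

lemma rank_enumeration:
  assumes mono: "\<And>i j. i \<in> {1..n} \<Longrightarrow> j \<in> {1..n} \<Longrightarrow> i < j \<Longrightarrow> r (c i) (c j)"
    and "asymp r" and i: "i \<in> {1..n}"
  shows "rank r (c ` {1..n}) (c i) = i"
proof -
  have asym: "r x y \<Longrightarrow> \<not> r y x" for x y using asympD[OF assms(2)] .
  have less: "r (c j) (c i) \<longleftrightarrow> j < i" if "j \<in> {1..n}" for j
    using mono[OF that i] mono[OF i that] asym by (metis linorder_neqE_nat)
  have inj: "inj_on c {1..n}"
    using mono asym by (intro inj_onI) (metis linorder_neqE_nat)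
  have "{y \<in> c ` {1..n}. r y (c i)} = c ` {1..<i}" using less i by auto
  moreover have "inj_on c {1..<i}" by (rule inj_on_subset[OF inj]) (use i in auto)
  ultimately show ?thesis using i by (simp add: rank_def card_image)
qed

lemma consecutive_trans:
  fixes P :: "nat \<Rightarrow> nat \<Rightarrow> bool"
  assumes step: "\<And>i. i \<in> {1..<n} \<Longrightarrow> P i (i + 1)"
    and trans: "\<And>i j k. P i j \<Longrightarrow> P j k \<Longrightarrow> P i k"
  shows "1 \<le> i \<Longrightarrow> i < j \<Longrightarrow> j \<le> n \<Longrightarrow> P i j"
proof (induction j)
  case (Suc j)
  show ?case
  proof (cases "i = j")
    case True
    then show ?thesis using step[of j] Suc.prems by simp
  next
    case False
    then show ?thesis using step[of j] trans[of i j "Suc j"] Suc by simp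
  qed
qed simp

text \<open>The two orders in which the cells of a set are listed. They break ties in opposite directions:
  this makes the sequence of first coordinates strict at the descents of a signed permutation and
  the sequence of second coordinates strict at the ascents of its inverse.\<close>

definition before_x :: "nat \<times> nat \<Rightarrow> nat \<times> nat \<Rightarrow> bool" where
  "before_x c d \<longleftrightarrow> fst d < fst c \<or> fst d = fst c \<and> snd d < snd c"

definition before_y :: "nat \<times> nat \<Rightarrow> nat \<times> nat \<Rightarrow> bool" where
  "before_y c d \<longleftrightarrow> snd d < snd c \<or> snd d = snd c \<and> fst c < fst d"

lemma before_x_order: "asymp before_x" "transp before_x" "totalp before_x"
  by (auto intro!: asympI transpI totalpI simp: before_x_def prod_eq_iff)

lemma before_y_order: "asymp before_y" "transp before_y" "totalp before_y"
  by (auto intro!: asympI transpI totalpI simp: before_y_def prod_eq_iff)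

section \<open>Signed permutations\<close>

lemma B_zero: "\<beta> \<in> B n \<Longrightarrow> \<beta> 0 = 0"
  by (simp add: B_def) (metis neg_equal_0_iff_equal equal_neg_zero)

lemma B_minus: "\<beta> \<in> B n \<Longrightarrow> \<beta> (- x) = - \<beta> x"
  by (simp add: B_def)

lemma B_beyond: "\<beta> \<in> B n \<Longrightarrow> \<bar>x\<bar> > int n \<Longrightarrow> \<beta> x = x"
  by (simp add: B_def)

lemma B_abs: "\<beta> \<in> B n \<Longrightarrow> \<bar>\<beta> \<bar>x\<bar>\<bar> = \<bar>\<beta> x\<bar>"
  by (cases "x \<ge> 0") (auto simp: abs_if B_minus)

definition abs_perm :: "(int \<Rightarrow> int) \<Rightarrow> nat \<Rightarrow> nat" where
  "abs_perm \<beta> i = nat \<bar>\<beta> (int i)\<bar>"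

lemma int_abs_perm: "int (abs_perm \<beta> i) = \<bar>\<beta> (int i)\<bar>"
  by (simp add: abs_perm_def)

lemma B_abs_perm_bij:
  assumes "\<beta> \<in> B n"
  shows "bij_betw (abs_perm \<beta>) {1..n} {1..n}"
proof -
  have int: "bij_betw int {1..n} {1..int n}"
    by (rule bij_betwI[where g = nat]) auto
  have nat: "bij_betw nat {1..int n} {1..n}"
    by (rule bij_betwI[where g = int]) auto
  have "bij_betw (nat \<circ> (\<lambda>i. \<bar>\<beta> i\<bar>) \<circ> int) {1..n} {1..n}"
    using assms by (intro bij_betw_trans[OF int] bij_betw_trans[OF _ nat]) (simp add: B_def)
  moreover have "nat \<circ> (\<lambda>i. \<bar>\<beta> i\<bar>) \<circ> int = abs_perm \<beta>"
    by (auto simp: abs_perm_def)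
  ultimately show ?thesis by simp
qed

lemma abs_perm_mem: "\<beta> \<in> B n \<Longrightarrow> i \<in> {1..n} \<Longrightarrow> abs_perm \<beta> i \<in> {1..n}"
  using B_abs_perm_bij[of \<beta> n] by (auto simp: bij_betw_def)

lemma B_nonzero: "\<beta> \<in> B n \<Longrightarrow> i \<in> {1..n} \<Longrightarrow> \<beta> (int i) \<noteq> 0"
  using abs_perm_mem[of \<beta> n i] by (auto simp: abs_perm_def)

lemma B_cases:
  fixes x :: int
  obtains "x = 0" | "\<bar>x\<bar> > int n" | i where "i \<in> {1..n}" "x = int i" | i where "i \<in> {1..n}" "x = - int i"
proof -
  consider "x = 0" | "\<bar>x\<bar> > int n" | "0 < x" "x \<le> int n" | "x < 0" "- x \<le> int n" by linarith
  then show ?thesis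
  proof cases
    case 3
    then show ?thesis using that(3)[of "nat x"] by simp
  next
    case 4
    then show ?thesis using that(4)[of "nat (- x)"] by simp
  qed (use that in auto)
qed

lemma B_eqI:
  assumes "\<beta> \<in> B n" "\<beta>' \<in> B n" "\<And>i. i \<in> {1..n} \<Longrightarrow> \<beta> (int i) = \<beta>' (int i)"
  shows "\<beta> = \<beta>'"
proof
  fix x
  show "\<beta> x = \<beta>' x"
    by (cases x rule: B_cases[where n = n]) (use assms in \<open>auto simp: B_zero B_beyond B_minus\<close>)
qed

lemma finite_B: "finite (B n)"
proof (rule inj_on_finite)
  show "inj_on (\<lambda>\<beta>. \<lambda>i\<in>{1..n}. \<beta> (int i)) (B n)"
    by (intro inj_onI B_eqI) (auto simp: fun_eq_iff restrict_def split: if_splits)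
  show "(\<lambda>\<beta>. \<lambda>i\<in>{1..n}. \<beta> (int i)) ` B n \<subseteq> {1..n} \<rightarrow>\<^sub>E {- int n..int n}"
  proof (intro image_subsetI restrict_PiE_iff[THEN iffD2] ballI)
    fix \<beta> i assume "\<beta> \<in> B n" "i \<in> {1..n}"
    then have "int (abs_perm \<beta> i) \<le> int n" using abs_perm_mem by fastforce
    then show "\<beta> (int i) \<in> {- int n..int n}" unfolding int_abs_perm by auto
  qed
  show "finite ({1..n} \<rightarrow>\<^sub>E {- int n..int n})" by (intro finite_PiE) auto
qed

lemma B_inj:
  assumes "\<beta> \<in> B n"
  shows "inj \<beta>"
proof (rule injI)
  fix x y assume eq: "\<beta> x = \<beta> y"
  have le: "\<bar>\<beta> z\<bar> \<le> int n \<longleftrightarrow> \<bar>z\<bar> \<le> int n" for z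
  proof (cases z rule: B_cases[where n = n])
    case (3 i)
    then show ?thesis using abs_perm_mem[OF assms 3(1)] int_abs_perm[of \<beta> i] by simp
  next
    case (4 i)
    then show ?thesis using abs_perm_mem[OF assms 4(1)] int_abs_perm[of \<beta> i] B_minus[OF assms] by simp
  qed (use assms in \<open>simp_all add: B_zero B_beyond\<close>)
  have zero: "\<beta> z = 0 \<longleftrightarrow> z = 0" for z
    by (cases z rule: B_cases[where n = n])
      (use assms B_nonzero[OF assms] in \<open>auto simp: B_zero B_beyond B_minus\<close>)
  show "x = y"
  proof (cases "\<bar>x\<bar> \<le> int n")
    case False
    then show ?thesis using le[of x] le[of y] eq B_beyond[OF assms] by simp
  next
    case True
    show ?thesis
    proof (cases "x = 0")
      case True
      then show ?thesis using zero eq by metis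
    next
      case False
      then have "y \<noteq> 0" using zero eq by metis
      then have "\<bar>x\<bar> \<in> {1..int n}" "\<bar>y\<bar> \<in> {1..int n}"
        using False True le[of x] le[of y] eq by auto
      moreover have "\<bar>\<beta> \<bar>x\<bar>\<bar> = \<bar>\<beta> \<bar>y\<bar>\<bar>" using eq B_abs[OF assms] by simp
      ultimately have "\<bar>x\<bar> = \<bar>y\<bar>"
        using assms unfolding B_def bij_betw_def inj_on_def by blast
      then have "x = y \<or> x = - y" by linarith
      moreover have "x \<noteq> - y"
      proof
        assume "x = - y"
        then have "\<beta> y = 0" using eq B_minus[OF assms, of y] by simp
        then show False using zero \<open>y \<noteq> 0\<close> by simp
      qed
      ultimately show ?thesis by simp
    qed
  qed
qed

lemma B_inverse_abs:
  assumes "\<beta> \<in> B n" "i \<in> {1..n}"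
  shows "inv_into UNIV \<beta> (int (abs_perm \<beta> i)) = sgn (\<beta> (int i)) * int i"
proof (cases "\<beta> (int i) > 0")
  case True
  then have "int (abs_perm \<beta> i) = \<beta> (int i)" by (simp add: int_abs_perm)
  then show ?thesis using True B_inj[OF assms(1)] by simp
next
  case False
  then have "\<beta> (int i) < 0" using B_nonzero[OF assms] by linarith
  moreover from this have "int (abs_perm \<beta> i) = \<beta> (- int i)"
    using B_minus[OF assms(1)] by (simp add: int_abs_perm)
  ultimately show ?thesis using B_inj[OF assms(1)] by simp
qed

abbreviation inv_B :: "(int \<Rightarrow> int) \<Rightarrow> int \<Rightarrow> int" where
  "inv_B \<beta> \<equiv> inv_into UNIV \<beta>"

lemma
  assumes "\<beta> \<in> B n" "i \<in> {1..n}"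
  shows inv_B_abs_perm: "abs_perm (inv_B \<beta>) (abs_perm \<beta> i) = i"
    and inv_B_pos_iff: "inv_B \<beta> (int (abs_perm \<beta> i)) > 0 \<longleftrightarrow> \<beta> (int i) > 0"
    and inv_B_nonzero: "inv_B \<beta> (int (abs_perm \<beta> i)) \<noteq> 0"
  using B_inverse_abs[OF assms] B_nonzero[OF assms] assms(2)
  by (auto simp: abs_perm_def[of "inv_B \<beta>"] abs_mult abs_sgn_eq zero_less_mult_iff sgn_if split: if_splits)

lemma abs_perm_cases:
  assumes "\<beta> \<in> B n" "j \<in> {1..n}"
  obtains i where "i \<in> {1..n}" "j = abs_perm \<beta> i"
proof -
  have "j \<in> abs_perm \<beta> ` {1..n}"
    using assms(2) bij_betw_imp_surj_on[OF B_abs_perm_bij[OF assms(1)]] by simp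
  then show ?thesis using that by blast
qed

lemma
  assumes "\<beta> \<in> B n"
  shows inv_B_abs_inj: "inj_on (\<lambda>j. \<bar>inv_B \<beta> (int j)\<bar>) {1..n}"
    and inv_B_nonzero': "j \<in> {1..n} \<Longrightarrow> inv_B \<beta> (int j) \<noteq> 0"
proof -
  show "inj_on (\<lambda>j. \<bar>inv_B \<beta> (int j)\<bar>) {1..n}"
  proof (rule inj_onI)
    fix j k assume "j \<in> {1..n}" "k \<in> {1..n}" and eq: "\<bar>inv_B \<beta> (int j)\<bar> = \<bar>inv_B \<beta> (int k)\<bar>"
    then obtain i l where il: "i \<in> {1..n}" "j = abs_perm \<beta> i" "l \<in> {1..n}" "k = abs_perm \<beta> l"
      using abs_perm_cases[OF assms] by metis
    have "abs_perm (inv_B \<beta>) j = abs_perm (inv_B \<beta>) k" using eq by (simp add: abs_perm_def)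
    then show "j = k" using il inv_B_abs_perm[OF assms] by metis
  qed
  show "j \<in> {1..n} \<Longrightarrow> inv_B \<beta> (int j) \<noteq> 0"
    using abs_perm_cases[OF assms] inv_B_nonzero[OF assms] by metis
qed

lemma B_abs_inj: "\<beta> \<in> B n \<Longrightarrow> inj_on (\<lambda>i. \<bar>\<beta> (int i)\<bar>) {1..n}"
  using bij_betw_imp_inj_on[OF B_abs_perm_bij[of \<beta> n]]
  unfolding int_abs_perm[symmetric] inj_on_def of_nat_eq_iff .

section \<open>Sets of cells and signed permutations\<close>

definition x_seqs :: "nat \<Rightarrow> (int \<Rightarrow> int) \<Rightarrow> (nat \<Rightarrow> nat) set" where
  "x_seqs n \<beta> = parity_seqs n (\<lambda>i. \<beta> (int i) < 0) {i. \<bar>\<beta> (int i)\<bar> < \<bar>\<beta> (int (i + 1))\<bar>}"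

definition y_seqs :: "nat \<Rightarrow> (int \<Rightarrow> int) \<Rightarrow> (nat \<Rightarrow> nat) set" where
  "y_seqs n \<gamma> = parity_seqs n (\<lambda>j. \<gamma> (int j) > 0) {j. \<bar>\<gamma> (int (j + 1))\<bar> < \<bar>\<gamma> (int j)\<bar>}"

lemma x_seqs_iff: "a \<in> x_seqs n \<beta> \<longleftrightarrow> a \<in> {1..n} \<rightarrow>\<^sub>E UNIV \<and>
    (\<forall>i\<in>{1..n}. odd (a i) \<longleftrightarrow> \<beta> (int i) < 0) \<and>
    (\<forall>i\<in>{1..<n}. a (i + 1) < a i \<or> a (i + 1) = a i \<and> abs_perm \<beta> i < abs_perm \<beta> (i + 1))"
proof -
  have "\<bar>\<beta> (int i)\<bar> < \<bar>\<beta> (int j)\<bar> \<longleftrightarrow> abs_perm \<beta> i < abs_perm \<beta> j" for i j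
    unfolding int_abs_perm[symmetric] by simp
  then show ?thesis unfolding x_seqs_def parity_seqs_def mem_Collect_eq by (simp only:)
qed

lemma y_seqs_iff: "b \<in> y_seqs n \<gamma> \<longleftrightarrow> b \<in> {1..n} \<rightarrow>\<^sub>E UNIV \<and>
    (\<forall>j\<in>{1..n}. odd (b j) \<longleftrightarrow> \<gamma> (int j) > 0) \<and>
    (\<forall>j\<in>{1..<n}. b (j + 1) < b j \<or> b (j + 1) = b j \<and> abs_perm \<gamma> (j + 1) < abs_perm \<gamma> j)"
proof -
  have "\<bar>\<gamma> (int i)\<bar> < \<bar>\<gamma> (int j)\<bar> \<longleftrightarrow> abs_perm \<gamma> i < abs_perm \<gamma> j" for i j
    unfolding int_abs_perm[symmetric] by simp
  then show ?thesis unfolding y_seqs_def parity_seqs_def mem_Collect_eq by (simp only:)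
qed

text \<open>The codes of sets of cells: a signed permutation, the first coordinates in the order
  \<open>before_x\<close> and the second coordinates in the order \<open>before_y\<close>.\<close>

definition labelled_seqs :: "nat \<Rightarrow> ((int \<Rightarrow> int) \<times> (nat \<Rightarrow> nat) \<times> (nat \<Rightarrow> nat)) set" where
  "labelled_seqs n = (SIGMA \<beta>:B n. x_seqs n \<beta> \<times> y_seqs n (inv_B \<beta>))"

fun cell_at :: "(int \<Rightarrow> int) \<times> (nat \<Rightarrow> nat) \<times> (nat \<Rightarrow> nat) \<Rightarrow> nat \<Rightarrow> nat \<times> nat" where
  "cell_at (\<beta>, a, b) i = (a i, b (abs_perm \<beta> i))"

text \<open>The tie rules of the two sequences control each other. If two entries of \<open>a\<close> agree, then the
  absolute values of \<open>\<beta>\<close> increase, so the corresponding entries of \<open>b\<close> decrease weakly; equality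
  there would make the absolute values of the inverse decrease, which is impossible. So the cells
  are distinct, and they appear in the order \<open>before_x\<close>; likewise for \<open>before_y\<close>. Consequently the
  code can be read off from the ranks.\<close>

lemma
  assumes t: "(\<beta>, a, b) \<in> labelled_seqs n"
  defines "S \<equiv> cell_at (\<beta>, a, b) ` {1..n}"
  shows cell_at_rank_x: "\<And>i. i \<in> {1..n} \<Longrightarrow> rank before_x S (cell_at (\<beta>, a, b) i) = i"
    and cell_at_rank_y: "\<And>i. i \<in> {1..n} \<Longrightarrow> rank before_y S (cell_at (\<beta>, a, b) i) = abs_perm \<beta> i"
    and cell_at_inj: "inj_on (cell_at (\<beta>, a, b)) {1..n}"
    and cell_at_cell_sets: "S \<in> cell_sets n"
proof -
  let ?p = "abs_perm \<beta>" and ?r = "abs_perm (inv_B \<beta>)" and ?c = "cell_at (\<beta>, a, b)"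
  \<comment> \<open>The same cells, indexed by the position of the second coordinate.\<close>
  define d where "d j = (a (?r j), b j)" for j
  have \<beta>: "\<beta> \<in> B n" and a: "a \<in> x_seqs n \<beta>" and b: "b \<in> y_seqs n (inv_B \<beta>)"
    using t by (auto simp: labelled_seqs_def)
  have a_mono: "a j < a i \<or> a j = a i \<and> ?p i < ?p j" if "1 \<le> i" "i < j" "j \<le> n" for i j
    using _ _ that
  proof (rule consecutive_trans)
    show "a (i + 1) < a i \<or> a (i + 1) = a i \<and> ?p i < ?p (i + 1)" if "i \<in> {1..<n}" for i
      using a that unfolding x_seqs_iff by blast
  qed auto
  have b_mono: "b j < b i \<or> b j = b i \<and> ?r j < ?r i" if "1 \<le> i" "i < j" "j \<le> n" for i j
    using _ _ that
  proof (rule consecutive_trans)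
    show "b (i + 1) < b i \<or> b (i + 1) = b i \<and> ?r (i + 1) < ?r i" if "i \<in> {1..<n}" for i
      using b that unfolding y_seqs_iff by blast
  qed auto
  have mem: "?p i \<in> {1..n}" if "i \<in> {1..n}" for i using abs_perm_mem[OF \<beta> that] .
  have rp: "?r (?p i) = i" if "i \<in> {1..n}" for i using inv_B_abs_perm[OF \<beta> that] .
  have cd: "?c i = d (?p i)" if "i \<in> {1..n}" for i using rp[OF that] by (simp add: d_def)
  have pr: "?r j \<in> {1..n} \<and> ?p (?r j) = j" if j: "j \<in> {1..n}" for j
    using abs_perm_cases[OF \<beta> j] rp by metis
  have bx: "before_x (?c i) (?c j)" if ij: "i \<in> {1..n}" "j \<in> {1..n}" "i < j" for i j
  proof (cases "a j < a i")
    case False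
    then have "a j = a i" "?p i < ?p j" using a_mono[of i j] ij by auto
    then have "b (?p j) < b (?p i)"
      using b_mono[of "?p i" "?p j"] mem[OF ij(1)] mem[OF ij(2)] rp[OF ij(1)] rp[OF ij(2)] ij(3) by auto
    then show ?thesis using \<open>a j = a i\<close> by (simp add: before_x_def)
  qed (simp add: before_x_def)
  have b_y: "before_y (d i) (d j)" if ij: "i \<in> {1..n}" "j \<in> {1..n}" "i < j" for i j
  proof (cases "b j < b i")
    case False
    then have "b j = b i" "?r j < ?r i" using b_mono[of i j] ij by auto
    then have "a (?r i) < a (?r j)"
      using a_mono[of "?r j" "?r i"] pr[OF ij(1)] pr[OF ij(2)] ij(3) by auto
    then show ?thesis using \<open>b j = b i\<close> by (simp add: before_y_def d_def)
  qed (simp add: before_y_def d_def)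
  have "S = d ` {1..n}"
    using cd B_abs_perm_bij[OF \<beta>] unfolding S_def bij_betw_def
    by (metis (no_types, lifting) image_cong image_image)
  then show "rank before_y S (?c i) = ?p i" if "i \<in> {1..n}" for i
    using rank_enumeration[of n before_y d, OF b_y before_y_order(1) mem[OF that]] cd[OF that] by simp
  show rank_x: "rank before_x S (?c i) = i" if "i \<in> {1..n}" for i
    unfolding S_def using rank_enumeration[of n before_x ?c, OF bx before_x_order(1) that] .
  show inj: "inj_on ?c {1..n}"
    using rank_x by (intro inj_onI) metis
  have "?c i \<in> cells" if i: "i \<in> {1..n}" for i
  proof -
    have "odd (a i) \<longleftrightarrow> \<beta> (int i) < 0" using a i unfolding x_seqs_iff by blast
    moreover have "odd (b (?p i)) \<longleftrightarrow> \<beta> (int i) > 0"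
      using b mem[OF i] inv_B_pos_iff[OF \<beta> i] unfolding y_seqs_iff by blast
    ultimately show ?thesis using B_nonzero[OF \<beta> i] by (auto simp: cells_def)
  qed
  then show "S \<in> cell_sets n"
    using card_image[OF inj] by (auto simp: cell_sets_def S_def simp del: cell_at.simps)
qed

lemma labelled_seqs_inj: "inj_on (\<lambda>t. cell_at t ` {1..n}) (labelled_seqs n)"
proof (rule inj_onI)
  fix t t' assume t: "t \<in> labelled_seqs n" and t': "t' \<in> labelled_seqs n"
    and eq: "cell_at t ` {1..n} = cell_at t' ` {1..n}"
  obtain \<beta> a b \<beta>' a' b' where split: "t = (\<beta>, a, b)" "t' = (\<beta>', a', b')" by (metis prod_cases3)
  let ?S = "cell_at t ` {1..n}"
  have mem: "\<beta> \<in> B n" "a \<in> x_seqs n \<beta>" "b \<in> y_seqs n (inv_B \<beta>)"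
    "\<beta>' \<in> B n" "a' \<in> x_seqs n \<beta>'" "b' \<in> y_seqs n (inv_B \<beta>')"
    using t t' by (auto simp: split labelled_seqs_def)
  have fin: "finite ?S" by simp
  have inj: "inj_on (rank before_x ?S) ?S"
    using rank_bij[OF fin before_x_order(1-3)] unfolding bij_betw_def by blast
  have cell: "cell_at t i = cell_at t' i" if i: "i \<in> {1..n}" for i
  proof (rule inj_onD[OF inj])
    show "rank before_x ?S (cell_at t i) = rank before_x ?S (cell_at t' i)"
      using cell_at_rank_x[OF t[unfolded split] i] cell_at_rank_x[OF t'[unfolded split] i] eq
      by (simp add: split)
  qed (use i eq in auto)
  have p: "abs_perm \<beta> i = abs_perm \<beta>' i" if i: "i \<in> {1..n}" for i
    using cell_at_rank_y[OF t[unfolded split] i] cell_at_rank_y[OF t'[unfolded split] i] eq cell[OF i]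
    by (simp add: split)
  have ab: "a i = a' i" "b (abs_perm \<beta> i) = b' (abs_perm \<beta> i)" if i: "i \<in> {1..n}" for i
    using cell[OF i] p[OF i] by (simp_all add: split)
  have "\<beta> = \<beta>'"
  proof (rule B_eqI[OF mem(1,4)])
    fix i assume i: "i \<in> {1..n}"
    have "\<beta> (int i) < 0 \<longleftrightarrow> \<beta>' (int i) < 0"
      using mem(2,5) i ab(1)[OF i] unfolding x_seqs_iff by metis
    moreover have "\<bar>\<beta> (int i)\<bar> = \<bar>\<beta>' (int i)\<bar>" using p[OF i] by (metis int_abs_perm)
    ultimately show "\<beta> (int i) = \<beta>' (int i)" by linarith
  qed
  moreover have "a = a'"
    using mem(2,5) ab(1) unfolding x_seqs_iff by (blast intro: PiE_ext)
  moreover have "b = b'"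
  proof (rule PiE_ext)
    show "b \<in> {1..n} \<rightarrow>\<^sub>E UNIV" "b' \<in> {1..n} \<rightarrow>\<^sub>E UNIV" using mem(3,6) unfolding y_seqs_iff by blast+
    show "b j = b' j" if "j \<in> {1..n}" for j
      using abs_perm_cases[OF mem(1) that] ab(2) by metis
  qed
  ultimately show "t = t'" by (simp add: split)
qed

text \<open>The code of \<open>S\<close> is built from its two enumerations: \<open>\<beta>\<close> takes a rank in \<open>before_x\<close> to the rank of the
  same cell in \<open>before_y\<close>, with a negative sign when the first coordinate is odd. Since the
  coordinates of a cell have opposite parities, this sign also records the parity of the second
  coordinate.\<close>

lemma labelled_seqs_surj:
  assumes S: "S \<in> cell_sets n"
  shows "\<exists>t\<in>labelled_seqs n. cell_at t ` {1..n} = S"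
proof -
  have fin: "finite S" and card: "card S = n" and cells: "S \<subseteq> cells"
    using S by (auto simp: cell_sets_def)
  let ?x = "rank before_x S" and ?y = "rank before_y S"
  note rank_x = rank_less_iff[OF fin before_x_order(1-3)]
    and rank_y = rank_less_iff[OF fin before_y_order(1-3)]
  have bij_x: "bij_betw ?x S {1..n}" using rank_bij[OF fin before_x_order(1-3)] card by simp
  have bij_y: "bij_betw ?y S {1..n}" using rank_bij[OF fin before_y_order(1-3)] card by simp
  define c where "c = inv_into S ?x"
  define d where "d = inv_into S ?y"
  have bij_c: "bij_betw c {1..n} S" unfolding c_def using bij_betw_inv_into[OF bij_x] .
  have bij_d: "bij_betw d {1..n} S" unfolding d_def using bij_betw_inv_into[OF bij_y] .
  have cS: "c i \<in> S" and xc: "?x (c i) = i" if "i \<in> {1..n}" for i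
    using that bij_c bij_betw_inv_into_right[OF bij_x] by (auto simp: c_def bij_betw_def)
  have dS: "d j \<in> S" and yd: "?y (d j) = j" if "j \<in> {1..n}" for j
    using that bij_d bij_betw_inv_into_right[OF bij_y] by (auto simp: d_def bij_betw_def)
  have cx: "c (?x s) = s" and dy: "d (?y s) = s" if "s \<in> S" for s
    using that bij_betw_inv_into_left[OF bij_x] bij_betw_inv_into_left[OF bij_y]
    by (simp_all add: c_def d_def)
  have xS: "?x s \<in> {1..n}" and yS: "?y s \<in> {1..n}" if "s \<in> S" for s
    using that bij_x bij_y by (auto simp: bij_betw_def)
  define \<epsilon> where "\<epsilon> s = (if odd (fst s) then - 1 else 1 :: int)" for s :: "nat \<times> nat"
  \<comment> \<open>Odd, and the identity beyond \<open>n\<close>, as required of elements of \<open>B n\<close>.\<close>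
  define \<beta> where "\<beta> z = (if z = 0 \<or> \<bar>z\<bar> > int n then z
      else sgn z * (\<epsilon> (c (nat \<bar>z\<bar>)) * int (?y (c (nat \<bar>z\<bar>)))))" for z
  have \<beta>_at: "\<beta> (int i) = \<epsilon> (c i) * int (?y (c i))" if "i \<in> {1..n}" for i
    using that by (simp add: \<beta>_def)
  have p: "abs_perm \<beta> i = ?y (c i)" if "i \<in> {1..n}" for i
    using that by (simp add: abs_perm_def \<beta>_at abs_mult \<epsilon>_def)
  have \<beta>B: "\<beta> \<in> B n"
    unfolding B_def
  proof (intro CollectI conjI allI impI)
    have nat: "bij_betw nat {1..int n} {1..n}"
      by (rule bij_betwI[where g = int]) auto
    have int: "bij_betw int {1..n} {1..int n}"
      by (rule bij_betwI[where g = nat]) auto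
    have "bij_betw (int \<circ> (?y \<circ> c) \<circ> nat) {1..int n} {1..int n}"
      by (intro bij_betw_trans[OF nat] bij_betw_trans[OF _ int] bij_betw_trans[OF bij_c bij_y])
    moreover have "(int \<circ> (?y \<circ> c) \<circ> nat) z = \<bar>\<beta> z\<bar>" if "z \<in> {1..int n}" for z
    proof -
      have "nat z \<in> {1..n}" "int (nat z) = z" using that by auto
      then show ?thesis using p[of "nat z"] int_abs_perm[of \<beta> "nat z"] by simp
    qed
    then have "bij_betw (int \<circ> (?y \<circ> c) \<circ> nat) {1..int n} {1..int n}
        = bij_betw (\<lambda>z. \<bar>\<beta> z\<bar>) {1..int n} {1..int n}"
      by (rule bij_betw_cong)
    ultimately show "bij_betw (\<lambda>z. \<bar>\<beta> z\<bar>) {1..int n} {1..int n}" by simp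
  qed (simp_all add: \<beta>_def)
  have sign: "\<beta> (int i) < 0 \<longleftrightarrow> odd (fst (c i))" "\<beta> (int i) > 0 \<longleftrightarrow> even (fst (c i))"
    if "i \<in> {1..n}" for i
    using yS[OF cS[OF that]] by (simp_all add: \<beta>_at[OF that] \<epsilon>_def)
  have r: "abs_perm (inv_B \<beta>) j = ?x (d j)"
    and sign': "inv_B \<beta> (int j) > 0 \<longleftrightarrow> even (fst (d j))" if j: "j \<in> {1..n}" for j
  proof -
    have i: "?x (d j) \<in> {1..n}" using xS[OF dS[OF j]] .
    have c: "c (?x (d j)) = d j" using cx[OF dS[OF j]] .
    have j': "j = abs_perm \<beta> (?x (d j))" using p[OF i] c yd[OF j] by simp
    show "abs_perm (inv_B \<beta>) j = ?x (d j)" using inv_B_abs_perm[OF \<beta>B i] j' by simp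
    show "inv_B \<beta> (int j) > 0 \<longleftrightarrow> even (fst (d j))"
      using inv_B_pos_iff[OF \<beta>B i] sign(2)[OF i] j' c by simp
  qed
  let ?a = "\<lambda>i\<in>{1..n}. fst (c i)" and ?b = "\<lambda>j\<in>{1..n}. snd (d j)"
  have "?a \<in> x_seqs n \<beta>"
    unfolding x_seqs_iff
  proof (intro conjI ballI)
    fix i assume i: "i \<in> {1..<n}"
    then have mem: "i \<in> {1..n}" "i + 1 \<in> {1..n}" by auto
    have "before_x (c i) (c (i + 1))"
      using rank_x[OF cS[OF mem(1)] cS[OF mem(2)]]
        xc[OF mem(1)] xc[OF mem(2)] by simp
    then have "fst (c (i + 1)) < fst (c i) \<or>
        fst (c (i + 1)) = fst (c i) \<and> before_y (c i) (c (i + 1))"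
      by (auto simp: before_x_def before_y_def)
    then show "?a (i + 1) < ?a i \<or> ?a (i + 1) = ?a i \<and> abs_perm \<beta> i < abs_perm \<beta> (i + 1)"
      using rank_y[OF cS[OF mem(1)] cS[OF mem(2)]]
        mem p[OF mem(1)] p[OF mem(2)] by simp
  qed (use sign in auto)
  moreover have "?b \<in> y_seqs n (inv_B \<beta>)"
    unfolding y_seqs_iff
  proof (intro conjI ballI)
    fix j assume j: "j \<in> {1..<n}"
    then have mem: "j \<in> {1..n}" "j + 1 \<in> {1..n}" by auto
    have "before_y (d j) (d (j + 1))"
      using rank_y[OF dS[OF mem(1)] dS[OF mem(2)]]
        yd[OF mem(1)] yd[OF mem(2)] by simp
    then have "snd (d (j + 1)) < snd (d j) \<or>
        snd (d (j + 1)) = snd (d j) \<and> before_x (d (j + 1)) (d j)"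
      by (auto simp: before_x_def before_y_def)
    then show "?b (j + 1) < ?b j \<or>
        ?b (j + 1) = ?b j \<and> abs_perm (inv_B \<beta>) (j + 1) < abs_perm (inv_B \<beta>) j"
      using rank_x[OF dS[OF mem(2)] dS[OF mem(1)]]
        mem r[OF mem(1)] r[OF mem(2)] by simp
  next
    fix j assume j: "j \<in> {1..n}"
    have "odd (fst (d j) + snd (d j))" using dS[OF j] cells by (auto simp: cells_def)
    then show "odd (?b j) \<longleftrightarrow> inv_B \<beta> (int j) > 0" using sign'[OF j] j by auto
  qed auto
  ultimately have t: "(\<beta>, ?a, ?b) \<in> labelled_seqs n" using \<beta>B by (simp add: labelled_seqs_def)
  have "cell_at (\<beta>, ?a, ?b) i = c i" if i: "i \<in> {1..n}" for i
    using i p[OF i] yS[OF cS[OF i]] dy[OF cS[OF i]] by simp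
  then have "cell_at (\<beta>, ?a, ?b) ` {1..n} = S" using bij_c by (simp add: bij_betw_def)
  then show ?thesis using t by blast
qed

lemma gf_cell_sets:
  "gf (cell_sets n) (\<lambda>S. \<Sum>c\<in>S. c)
    = (\<Sum>\<beta>\<in>B n. q_fps ^ fmaj n \<beta> * t_fps ^ (n ^ 2 - fmaj n (inv_B \<beta>)))
        * (\<Prod>i=1..n. 1 / (1 - q_fps ^ (2 * i))) * (\<Prod>i=1..n. 1 / (1 - t_fps ^ (2 * i)))"
proof -
  let ?u = "\<lambda>a. scale_weight (\<Sum>i\<in>{1..n}. a i) (1, 0)" and ?v = "\<lambda>b. scale_weight (\<Sum>j\<in>{1..n}. b j) (0, 1)"
  let ?Q = "\<Prod>i=1..n. 1 / (1 - q_fps ^ (2 * i))" and ?T = "\<Prod>i=1..n. 1 / (1 - t_fps ^ (2 * i))"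
  have q: "qt_monom (1, 0) = q_fps" and t: "qt_monom (0, 1) = t_fps"
    by (simp_all add: qt_monom_def)
  have fin_x: "finite_fibres (x_seqs n \<beta>) ?u" for \<beta>
    unfolding x_seqs_def by (rule finite_fibres_parity_seqs) simp
  have fin_y: "finite_fibres (y_seqs n \<gamma>) ?v" for \<gamma>
    unfolding y_seqs_def by (rule finite_fibres_parity_seqs) simp
  have nz: "(1, 0) \<noteq> (0 :: nat, 0 :: nat)" "(0, 1) \<noteq> (0 :: nat, 0 :: nat)" by simp_all
  have gf_x: "gf (x_seqs n \<beta>) ?u = q_fps ^ fmaj n \<beta> * ?Q" if "\<beta> \<in> B n" for \<beta>
  proof -
    have "forced_gaps n (\<lambda>i. \<beta> (int i) < 0) {i. \<bar>\<beta> (int i)\<bar> < \<bar>\<beta> (int (i + 1))\<bar>} = Des n \<beta>"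
      by (rule forced_gaps_Des[OF B_abs_inj[OF that]]) (rule B_nonzero[OF that])
    then show ?thesis
      unfolding x_seqs_def gf_parity_seqs[of "(1, 0)", OF nz(1)]
      by (simp only: qt_monom_scale q fmaj_def maj_def neg_def)
  qed
  have gf_y: "gf (y_seqs n (inv_B \<beta>)) ?v = t_fps ^ (n ^ 2 - fmaj n (inv_B \<beta>)) * ?T"
    if "\<beta> \<in> B n" for \<beta>
  proof -
    have "forced_gaps n (\<lambda>j. inv_B \<beta> (int j) > 0)
        {j. \<bar>inv_B \<beta> (int (j + 1))\<bar> < \<bar>inv_B \<beta> (int j)\<bar>} = {1..<n} - Des n (inv_B \<beta>)"
      by (rule forced_gaps_Asc[OF inv_B_abs_inj[OF that]]) (rule inv_B_nonzero'[OF that])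
    moreover have "2 * (\<Sum>i\<in>{1..<n} - Des n (inv_B \<beta>). i) + card {j\<in>{1..n}. inv_B \<beta> (int j) > 0}
        = n ^ 2 - fmaj n (inv_B \<beta>)"
      by (rule fmaj_complement) (rule inv_B_nonzero'[OF that])
    ultimately show ?thesis
      unfolding y_seqs_def gf_parity_seqs[of "(0, 1)", OF nz(2)]
      by (simp only: qt_monom_scale t)
  qed
  have "gf (labelled_seqs n) (\<lambda>(\<beta>, ab). (\<lambda>(a, b). ?u a + ?v b) ab) = gf (cell_sets n) (\<lambda>S. \<Sum>c\<in>S. c)"
  proof (rule gf_bij)
    show "bij_betw (\<lambda>t. cell_at t ` {1..n}) (labelled_seqs n) (cell_sets n)"
      unfolding bij_betw_def
    proof
      show "(\<lambda>t. cell_at t ` {1..n}) ` labelled_seqs n = cell_sets n"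
      proof (intro equalityI subsetI)
        fix S assume "S \<in> (\<lambda>t. cell_at t ` {1..n}) ` labelled_seqs n"
        then obtain \<beta> a b where "(\<beta>, a, b) \<in> labelled_seqs n" "S = cell_at (\<beta>, a, b) ` {1..n}"
          by (auto simp del: cell_at.simps)
        then show "S \<in> cell_sets n" using cell_at_cell_sets by blast
      qed (use labelled_seqs_surj in blast)
    qed (rule labelled_seqs_inj)
    fix t assume t: "t \<in> labelled_seqs n"
    obtain \<beta> a b where t_eq: "t = (\<beta>, a, b)" by (metis prod_cases3)
    have \<beta>: "\<beta> \<in> B n" using t by (auto simp: t_eq labelled_seqs_def)
    have "(\<Sum>c\<in>cell_at t ` {1..n}. c) = (\<Sum>i\<in>{1..n}. cell_at t i)"
      using sum.reindex[OF cell_at_inj[OF t[unfolded t_eq]], of "\<lambda>c. c"]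
      by (simp add: t_eq del: cell_at.simps)
    moreover have "(\<Sum>i\<in>{1..n}. b (abs_perm \<beta> i)) = (\<Sum>j\<in>{1..n}. b j)"
      by (rule sum.reindex_bij_betw[OF B_abs_perm_bij[OF \<beta>]])
    ultimately show "(\<Sum>c\<in>cell_at t ` {1..n}. c) = (case t of (\<beta>, ab) \<Rightarrow> (\<lambda>(a, b). ?u a + ?v b) ab)"
      by (simp add: t_eq prod_eq_iff fst_sum snd_sum scale_weight_def)
  qed
  also have "gf (labelled_seqs n) (\<lambda>(\<beta>, ab). (\<lambda>(a, b). ?u a + ?v b) ab)
      = (\<Sum>\<beta>\<in>B n. gf (x_seqs n \<beta> \<times> y_seqs n (inv_B \<beta>)) (\<lambda>(a, b). ?u a + ?v b))"
    unfolding labelled_seqs_def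
    by (rule gf_Sigma[OF finite_B]) (rule finite_fibres_Times[OF fin_x fin_y])
  also have "\<dots> = (\<Sum>\<beta>\<in>B n. (q_fps ^ fmaj n \<beta> * t_fps ^ (n ^ 2 - fmaj n (inv_B \<beta>))) * (?Q * ?T))"
    by (rule sum.cong) (simp_all only: gf_Times[OF fin_x fin_y] gf_x gf_y mult_ac)
  finally show ?thesis by (simp add: sum_distrib_right mult.assoc)
qed

section \<open>Coefficients of alternating polynomials\<close>

abbreviation coeff_of :: "('v, 'a::zero) mpoly \<Rightarrow> ('v \<Rightarrow>\<^sub>0 nat) \<Rightarrow> 'a" where
  "coeff_of \<equiv> Poly_Mapping.lookup"

lemma coeff_of_scale [simp]: "coeff_of (scale c p) m = c * coeff_of p m"
proof -
  have "scale c p = Poly_Mapping.map ((*) c) p"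
    by (simp add: scale_def Const_def mult_map_scale_conv_mult)
  then show ?thesis by (simp add: Poly_Mapping.map.rep_eq when_def)
qed

definition xy_monom :: "nat \<Rightarrow> (nat \<Rightarrow> nat \<times> nat) \<Rightarrow> xy \<Rightarrow>\<^sub>0 nat" where
  "xy_monom n g = (\<Sum>i<n. Poly_Mapping.single (X (Suc i)) (fst (g i)) + Poly_Mapping.single (Y (Suc i)) (snd (g i)))"

lemma lookup_xy_monom:
  "Poly_Mapping.lookup (xy_monom n g) (X k) = (if k \<in> {1..n} then fst (g (k - 1)) else 0)"
  "Poly_Mapping.lookup (xy_monom n g) (Y k) = (if k \<in> {1..n} then snd (g (k - 1)) else 0)"
proof -
  have "Poly_Mapping.lookup (xy_monom n g) (X k) = (\<Sum>i<n. if i = k - 1 \<and> k \<noteq> 0 then fst (g i) else 0)"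
    unfolding xy_monom_def lookup_sum lookup_add
    by (rule sum.cong) (auto simp: lookup_single when_def)
  then show "Poly_Mapping.lookup (xy_monom n g) (X k) = (if k \<in> {1..n} then fst (g (k - 1)) else 0)"
    by (cases k) auto
  have "Poly_Mapping.lookup (xy_monom n g) (Y k) = (\<Sum>i<n. if i = k - 1 \<and> k \<noteq> 0 then snd (g i) else 0)"
    unfolding xy_monom_def lookup_sum lookup_add
    by (rule sum.cong) (auto simp: lookup_single when_def)
  then show "Poly_Mapping.lookup (xy_monom n g) (Y k) = (if k \<in> {1..n} then snd (g (k - 1)) else 0)"
    by (cases k) auto
qed

lemma xy_monom_eq_iff: "xy_monom n g = xy_monom n h \<longleftrightarrow> (\<forall>i<n. g i = h i)"
proof
  assume eq: "xy_monom n g = xy_monom n h"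
  show "\<forall>i<n. g i = h i"
  proof (intro allI impI)
    fix i assume "i < n"
    then show "g i = h i"
      using lookup_xy_monom[of n g "Suc i"] lookup_xy_monom[of n h "Suc i"] by (simp add: eq prod_eq_iff)
  qed
qed (simp add: xy_monom_def)

lemma keys_xy_monom: "Poly_Mapping.keys (xy_monom n g) \<subseteq> X ` {1..n} \<union> Y ` {1..n}"
proof
  fix v assume "v \<in> Poly_Mapping.keys (xy_monom n g)"
  then have "Poly_Mapping.lookup (xy_monom n g) v \<noteq> 0" by (simp add: in_keys_iff)
  then show "v \<in> X ` {1..n} \<union> Y ` {1..n}" by (cases v) (auto simp: lookup_xy_monom split: if_splits)
qed

lemma xy_monom_exhaust:
  assumes "Poly_Mapping.keys m \<subseteq> X ` {1..n} \<union> Y ` {1..n}"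
  obtains g where "m = xy_monom n g"
proof
  show "m = xy_monom n (\<lambda>i. (Poly_Mapping.lookup m (X (Suc i)), Poly_Mapping.lookup m (Y (Suc i))))"
  proof (rule poly_mapping_eqI)
    fix v
    have "Poly_Mapping.lookup m v = 0" if "v \<notin> X ` {1..n} \<union> Y ` {1..n}"
      using that assms by (auto simp: in_keys_iff)
    then show "Poly_Mapping.lookup m v = Poly_Mapping.lookup
        (xy_monom n (\<lambda>i. (Poly_Mapping.lookup m (X (Suc i)), Poly_Mapping.lookup m (Y (Suc i))))) v"
      by (cases v) (auto simp: lookup_xy_monom image_iff)
  qed
qed

lemma sum_XY:
  fixes F :: "xy \<Rightarrow> 'b::comm_monoid_add"
  shows "sum F (X ` {1..n} \<union> Y ` {1..n}) = (\<Sum>i<n. F (X (Suc i)) + F (Y (Suc i)))"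
proof -
  have "sum F (X ` {1..n} \<union> Y ` {1..n}) = sum F (X ` {1..n}) + sum F (Y ` {1..n})"
    by (rule sum.union_disjoint) auto
  also have "\<dots> = (\<Sum>i\<in>{1..n}. F (X i)) + (\<Sum>i\<in>{1..n}. F (Y i))"
    by (subst (1 2) sum.reindex) (auto simp: inj_on_def)
  also have "\<dots> = (\<Sum>i<n. F (X (Suc i))) + (\<Sum>i<n. F (Y (Suc i)))"
    by (simp add: sum.atLeast1_atMost_eq)
  finally show ?thesis by (simp add: sum.distrib)
qed

lemma prod_XY:
  fixes F :: "xy \<Rightarrow> 'b::comm_monoid_mult"
  shows "prod F (X ` {1..n} \<union> Y ` {1..n}) = (\<Prod>i<n. F (X (Suc i)) * F (Y (Suc i)))"
proof -
  have "prod F (X ` {1..n} \<union> Y ` {1..n}) = prod F (X ` {1..n}) * prod F (Y ` {1..n})"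
    by (rule prod.union_disjoint) auto
  also have "\<dots> = (\<Prod>i\<in>{1..n}. F (X i)) * (\<Prod>i\<in>{1..n}. F (Y i))"
    by (subst (1 2) prod.reindex) (auto simp: inj_on_def)
  also have "\<dots> = (\<Prod>i<n. F (X (Suc i))) * (\<Prod>i<n. F (Y (Suc i)))"
    by (simp add: prod.atLeast1_atMost_eq)
  finally show ?thesis by (simp add: prod.distrib)
qed

lemma deg_xy_monom: "deg_x (xy_monom n g) = fst (\<Sum>i<n. g i)" "deg_y (xy_monom n g) = snd (\<Sum>i<n. g i)"
proof -
  let ?A = "X ` {1..n} \<union> Y ` {1..n}"
  let ?l = "Poly_Mapping.lookup (xy_monom n g)"
  have "deg_x (xy_monom n g) = (\<Sum>v\<in>?A. if v \<in> range X then ?l v else 0)"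
    unfolding deg_x_def sum.inter_restrict[OF finite_keys]
    by (rule sum.mono_neutral_left) (use keys_xy_monom in \<open>auto simp: in_keys_iff\<close>)
  then show "deg_x (xy_monom n g) = fst (\<Sum>i<n. g i)"
    unfolding sum_XY by (auto simp: fst_sum lookup_xy_monom intro!: sum.cong)
  have "deg_y (xy_monom n g) = (\<Sum>v\<in>?A. if v \<in> range Y then ?l v else 0)"
    unfolding deg_y_def sum.inter_restrict[OF finite_keys]
    by (rule sum.mono_neutral_left) (use keys_xy_monom in \<open>auto simp: in_keys_iff\<close>)
  then show "deg_y (xy_monom n g) = snd (\<Sum>i<n. g i)"
    unfolding sum_XY by (auto simp: snd_sum lookup_xy_monom intro!: sum.cong)
qed

text \<open>Permutations act on \<open>{0..<n}\<close> from here on, to match the row and column indices in the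
  determinant that defines the sign; index \<open>i\<close> stands for the variables with subscript \<open>i + 1\<close>.\<close>

definition index_perm :: "nat \<Rightarrow> (int \<Rightarrow> int) \<Rightarrow> nat \<Rightarrow> nat" where
  "index_perm n \<beta> i = (if i < n then abs_perm \<beta> (Suc i) - 1 else i)"

definition index_sign :: "(int \<Rightarrow> int) \<Rightarrow> nat \<Rightarrow> rat" where
  "index_sign \<beta> i = of_int (sgn (\<beta> (int (Suc i))))"

lemma abs_perm_Suc:
  assumes "\<beta> \<in> B n" "i < n"
  shows "abs_perm \<beta> (Suc i) = Suc (index_perm n \<beta> i)" "index_perm n \<beta> i < n"
  using abs_perm_mem[OF assms(1), of "Suc i"] assms(2) by (auto simp: index_perm_def)

lemma index_perm_permutes:
  assumes "\<beta> \<in> B n"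
  shows "index_perm n \<beta> permutes {0..<n}"
proof (rule bij_imp_permutes)
  have "inj_on (index_perm n \<beta>) {0..<n}"
  proof (rule inj_onI)
    fix i j assume "i \<in> {0..<n}" "j \<in> {0..<n}" "index_perm n \<beta> i = index_perm n \<beta> j"
    then have "abs_perm \<beta> (Suc i) = abs_perm \<beta> (Suc j)" "Suc i \<in> {1..n}" "Suc j \<in> {1..n}"
      using abs_perm_Suc[OF assms] by auto
    then show "i = j"
      using inj_onD[OF bij_betw_imp_inj_on[OF B_abs_perm_bij[OF assms]]] by blast
  qed
  moreover have "index_perm n \<beta> ` {0..<n} \<subseteq> {0..<n}" using abs_perm_Suc(2)[OF assms] by auto
  ultimately show "bij_betw (index_perm n \<beta>) {0..<n} {0..<n}"
    by (simp add: bij_betw_def endo_inj_surj)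
qed (simp add: index_perm_def)

lemma index_sign_cases: "\<beta> \<in> B n \<Longrightarrow> i < n \<Longrightarrow> index_sign \<beta> i = 1 \<or> index_sign \<beta> i = - 1"
  using B_nonzero[of \<beta> n "Suc i"] by (auto simp: index_sign_def sgn_if)

definition signed_perm :: "nat \<Rightarrow> (nat \<Rightarrow> nat) \<Rightarrow> (nat \<Rightarrow> int) \<Rightarrow> int \<Rightarrow> int" where
  "signed_perm n \<sigma> \<epsilon> z = (if z = 0 \<or> \<bar>z\<bar> > int n then z
     else sgn z * (\<epsilon> (nat \<bar>z\<bar> - 1) * int (Suc (\<sigma> (nat \<bar>z\<bar> - 1)))))"

lemma
  assumes \<sigma>: "\<sigma> permutes {0..<n}" and \<epsilon>: "\<And>i. i < n \<Longrightarrow> \<bar>\<epsilon> i\<bar> = 1"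
  shows signed_perm_B: "signed_perm n \<sigma> \<epsilon> \<in> B n"
    and index_perm_signed_perm: "index_perm n (signed_perm n \<sigma> \<epsilon>) = \<sigma>"
    and index_sign_signed_perm: "i < n \<Longrightarrow> index_sign (signed_perm n \<sigma> \<epsilon>) i = of_int (\<epsilon> i)"
proof -
  let ?\<beta> = "signed_perm n \<sigma> \<epsilon>"
  have at: "?\<beta> (int (Suc i)) = \<epsilon> i * int (Suc (\<sigma> i))" if "i < n" for i
    using that by (simp add: signed_perm_def nat_add_distrib)
  have abs: "\<bar>?\<beta> (int (Suc i))\<bar> = int (Suc (\<sigma> i))" if "i < n" for i
    unfolding at[OF that] abs_mult \<epsilon>[OF that] by simp
  show "?\<beta> \<in> B n"
    unfolding B_def
  proof (intro CollectI conjI allI impI)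
    let ?s = "\<lambda>i. int (Suc i)"
    have s: "bij_betw ?s {0..<n} {1..int n}"
      by (rule bij_betwI[where g = "\<lambda>z. nat z - 1"]) auto
    have "bij_betw (?s \<circ> \<sigma> \<circ> inv_into {0..<n} ?s) {1..int n} {1..int n}"
      by (intro bij_betw_trans[OF bij_betw_inv_into[OF s]] bij_betw_trans[OF permutes_imp_bij[OF \<sigma>]] s)
    moreover have "(?s \<circ> \<sigma> \<circ> inv_into {0..<n} ?s) z = \<bar>?\<beta> z\<bar>" if "z \<in> {1..int n}" for z
    proof -
      from that obtain i where i: "i \<in> {0..<n}" "z = ?s i"
        using bij_betw_imp_surj_on[OF s] by blast
      then show ?thesis using abs[of i] bij_betw_inv_into_left[OF s i(1)] by simp
    qed
    then have "bij_betw (?s \<circ> \<sigma> \<circ> inv_into {0..<n} ?s) {1..int n} {1..int n}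
        = bij_betw (\<lambda>z. \<bar>?\<beta> z\<bar>) {1..int n} {1..int n}"
      by (rule bij_betw_cong)
    ultimately show "bij_betw (\<lambda>z. \<bar>?\<beta> z\<bar>) {1..int n} {1..int n}" by simp
  qed (simp_all add: signed_perm_def)
  show "index_perm n ?\<beta> = \<sigma>"
  proof
    fix i
    show "index_perm n ?\<beta> i = \<sigma> i"
      using abs[of i] permutes_not_in[OF \<sigma>, of i] by (simp add: index_perm_def abs_perm_def nat_add_distrib)
  qed
  show "i < n \<Longrightarrow> index_sign ?\<beta> i = of_int (\<epsilon> i)"
    using \<epsilon>[of i] unfolding index_sign_def at[of i] sgn_mult by (auto simp: sgn_if abs_if split: if_splits)
qed

lemma act_var_Suc:
  assumes "\<beta> \<in> B n" "i < n"
  shows "act_var \<beta> (X (Suc i)) = Poly_Mapping.single (Poly_Mapping.single (X (Suc (index_perm n \<beta> i))) 1) (index_sign \<beta> i)"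
    and "act_var \<beta> (Y (Suc i)) = Poly_Mapping.single (Poly_Mapping.single (Y (Suc (index_perm n \<beta> i))) 1) (index_sign \<beta> i)"
  using abs_perm_Suc(1)[OF assms]
  by (simp_all add: index_sign_def abs_perm_def Const_def Var_def mult_single del: single_of_int)

lemma single_one_eq_iff:
  "Poly_Mapping.single v (1 :: nat) = Poly_Mapping.single w 1 \<longleftrightarrow> v = w"
  by (metis keys_single one_neq_zero singleton_inject)

text \<open>The matrix is monomial, so a single permutation survives in the Leibniz expansion by columns.\<close>

lemma sign_B_eq:
  assumes "\<beta> \<in> B n"
  shows "sign_B n \<beta> = of_int (sign (index_perm n \<beta>)) * (\<Prod>i<n. index_sign \<beta> i)"
proof -
  interpret Const: comm_ring_hom "Const :: rat \<Rightarrow> (xy, rat) mpoly" by (rule comm_ring_hom_Const)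
  let ?\<pi> = "index_perm n \<beta>"
  let ?A = "mat n n (\<lambda>(i, j). coeff_of (act \<beta> (Var (X (j + 1)))) (Poly_Mapping.single (X (i + 1)) 1))"
  have entry: "?A $$ (\<sigma> j, j) = (if \<sigma> j = ?\<pi> j then index_sign \<beta> j else 0)" if "\<sigma> permutes {0..<n}" "j < n" for \<sigma> j
  proof -
    have "\<sigma> j < n" using permutes_in_image[OF that(1), of j] that(2) by simp
    moreover have "coeff_of (act \<beta> (Var (X (j + 1)))) (Poly_Mapping.single (X (\<sigma> j + 1)) 1)
        = (if \<sigma> j = ?\<pi> j then index_sign \<beta> j else 0)"
      unfolding act_def Const.subst_Var Suc_eq_plus1[symmetric] act_var_Suc[OF assms that(2)]
        lookup_single when_def single_one_eq_iff by simp
    ultimately show ?thesis using that(2) by simp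
  qed
  have prod: "(\<Prod>j<n. ?A $$ (\<sigma> j, j)) = (if \<sigma> = ?\<pi> then \<Prod>j<n. index_sign \<beta> j else 0)"
    if "\<sigma> permutes {0..<n}" for \<sigma>
  proof -
    have "(\<Prod>j<n. ?A $$ (\<sigma> j, j)) = (\<Prod>j<n. if \<sigma> j = ?\<pi> j then index_sign \<beta> j else 0)"
      by (rule prod.cong[OF refl], rule entry[OF that]) simp
    also have "\<dots> = (if \<sigma> = ?\<pi> then \<Prod>j<n. index_sign \<beta> j else 0)"
    proof (cases "\<sigma> = ?\<pi>")
      case False
      then obtain j where "\<sigma> j \<noteq> ?\<pi> j" by auto
      moreover from this have "j < n"
        using permutes_not_in[OF that, of j] permutes_not_in[OF index_perm_permutes[OF assms], of j] by force
      ultimately show ?thesis using False by (auto intro!: prod_zero bexI[of _ j])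
    qed simp
    finally show ?thesis .
  qed
  have "det ?A = (\<Sum>\<sigma> | \<sigma> permutes {0..<n}. of_int (sign \<sigma>) * (\<Prod>j<n. ?A $$ (\<sigma> j, j)))"
    by (rule det_col) simp
  also have "\<dots> = (\<Sum>\<sigma> | \<sigma> permutes {0..<n}.
      of_int (sign \<sigma>) * (if \<sigma> = ?\<pi> then \<Prod>j<n. index_sign \<beta> j else 0))"
    by (rule sum.cong[OF refl]) (simp only: mem_Collect_eq prod)
  also have "\<dots> = (\<Sum>\<sigma> | \<sigma> permutes {0..<n}.
      if \<sigma> = ?\<pi> then of_int (sign ?\<pi>) * (\<Prod>j<n. index_sign \<beta> j) else 0)"
    by (rule sum.cong) auto
  also have "\<dots> = of_int (sign ?\<pi>) * (\<Prod>j<n. index_sign \<beta> j)"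
    using index_perm_permutes[OF assms] by (simp add: finite_permutations)
  finally show ?thesis by (simp add: sign_B_def)
qed

definition act_coeff :: "nat \<Rightarrow> (int \<Rightarrow> int) \<Rightarrow> (nat \<Rightarrow> nat \<times> nat) \<Rightarrow> rat" where
  "act_coeff n \<beta> h = (\<Prod>i<n. index_sign \<beta> i ^ (fst (h i) + snd (h i)))"

lemma prod_single: "(\<Prod>i\<in>A. Poly_Mapping.single (m i) (c i)) = Poly_Mapping.single (\<Sum>i\<in>A. m i) (\<Prod>i\<in>A. c i :: 'a::comm_semiring_1)"
  by (induction A rule: infinite_finite_induct) (simp_all add: mult_single)


lemma power_single_var:
  fixes c :: "'a::comm_semiring_1"
  shows "Poly_Mapping.single (Poly_Mapping.single v 1) c ^ k
    = Poly_Mapping.single (Poly_Mapping.single v k) (c ^ k)"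
  by (induction k) (simp_all add: mult_single flip: single_add)

lemma act_monom:
  assumes "\<beta> \<in> B n"
  shows "act \<beta> (Poly_Mapping.single (xy_monom n h) c)
    = Poly_Mapping.single (xy_monom n (h \<circ> inv_into UNIV (index_perm n \<beta>))) (c * act_coeff n \<beta> h)"
proof -
  interpret Const: comm_ring_hom "Const :: rat \<Rightarrow> (xy, rat) mpoly" by (rule comm_ring_hom_Const)
  let ?\<pi> = "index_perm n \<beta>" and ?l = "Poly_Mapping.lookup (xy_monom n h)"
  let ?s = "\<lambda>v k. Poly_Mapping.single v k :: xy \<Rightarrow>\<^sub>0 nat"
  have \<pi>: "?\<pi> permutes {0..<n}" by (rule index_perm_permutes[OF assms])
  have "(\<Prod>v\<in>Poly_Mapping.keys (xy_monom n h). act_var \<beta> v ^ ?l v)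
      = (\<Prod>v\<in>X ` {1..n} \<union> Y ` {1..n}. act_var \<beta> v ^ ?l v)"
    by (rule monom_value_superset) (use keys_xy_monom in auto)
  also have "\<dots> = (\<Prod>i<n. Poly_Mapping.single
      (?s (X (Suc (?\<pi> i))) (fst (h i)) + ?s (Y (Suc (?\<pi> i))) (snd (h i)))
      (index_sign \<beta> i ^ (fst (h i) + snd (h i))))"
    unfolding prod_XY
    by (rule prod.cong)
      (simp_all add: act_var_Suc[OF assms] lookup_xy_monom power_single_var[unfolded One_nat_def] mult_single power_add
        del: act_var.simps)
  also have "\<dots> = Poly_Mapping.single
      (\<Sum>i<n. ?s (X (Suc (?\<pi> i))) (fst (h i)) + ?s (Y (Suc (?\<pi> i))) (snd (h i))) (act_coeff n \<beta> h)"
    by (simp add: prod_single act_coeff_def)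
  also have "(\<Sum>i<n. ?s (X (Suc (?\<pi> i))) (fst (h i)) + ?s (Y (Suc (?\<pi> i))) (snd (h i)))
      = xy_monom n (h \<circ> inv_into UNIV ?\<pi>)"
  proof -
    have "bij_betw ?\<pi> {..<n} {..<n}" using permutes_imp_bij[OF \<pi>] by (simp add: atLeast0LessThan)
    then show ?thesis
      unfolding xy_monom_def
      by (subst sum.reindex_bij_betw[symmetric]) (auto simp: permutes_inverses[OF \<pi>])
  qed
  finally show ?thesis
    by (simp add: act_def Const.subst_single Const_def mult_single)
qed

lemma act_sum: "act \<beta> p = (\<Sum>m\<in>Poly_Mapping.keys p. act \<beta> (Poly_Mapping.single m (coeff_of p m)))"
proof -
  interpret Const: comm_ring_hom "Const :: rat \<Rightarrow> (xy, rat) mpoly" by (rule comm_ring_hom_Const)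
  have "act \<beta> p = act \<beta> (\<Sum>m\<in>Poly_Mapping.keys p. Poly_Mapping.single m (coeff_of p m))"
    by (simp flip: poly_mapping_sum_singles)
  then show ?thesis by (simp only: act_def Const.subst_sum)
qed

lemma R_iff: "p \<in> R n \<longleftrightarrow> (\<forall>m. coeff_of p m \<noteq> 0 \<longrightarrow> Poly_Mapping.keys m \<subseteq> X ` {1..n} \<union> Y ` {1..n})"
  unfolding R_def vars_def by (auto simp: in_keys_iff[symmetric])

lemma R_monomE:
  assumes "p \<in> R n" "m \<in> Poly_Mapping.keys p"
  obtains g where "m = xy_monom n g"
  using assms xy_monom_exhaust[of m n] unfolding R_iff in_keys_iff by blast

lemma coeff_act:
  assumes \<beta>: "\<beta> \<in> B n" and p: "p \<in> R n"
  shows "coeff_of (act \<beta> p) (xy_monom n g)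
    = act_coeff n \<beta> (g \<circ> index_perm n \<beta>) * coeff_of p (xy_monom n (g \<circ> index_perm n \<beta>))"
proof -
  let ?\<pi> = "index_perm n \<beta>"
  have \<pi>: "?\<pi> permutes {0..<n}" by (rule index_perm_permutes[OF \<beta>])
  have monom: "coeff_of (act \<beta> (Poly_Mapping.single m c)) (xy_monom n g)
      = (if m = xy_monom n (g \<circ> ?\<pi>) then act_coeff n \<beta> (g \<circ> ?\<pi>) * c else 0)"
    if m: "m \<in> Poly_Mapping.keys p" for m c
  proof -
    obtain h where h: "m = xy_monom n h" using R_monomE[OF p m] .
    have "(\<forall>i<n. h (inv_into UNIV ?\<pi> i) = g i) \<longleftrightarrow> (\<forall>i<n. h i = g (?\<pi> i))"
      using permutes_inverses[OF \<pi>] permutes_in_image[OF \<pi>] permutes_in_image[OF permutes_inv[OF \<pi>]]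
      by (metis atLeastLessThan_iff zero_le)
    then have "xy_monom n (h \<circ> inv_into UNIV ?\<pi>) = xy_monom n g \<longleftrightarrow> xy_monom n h = xy_monom n (g \<circ> ?\<pi>)"
      by (simp add: xy_monom_eq_iff)
    moreover have "act_coeff n \<beta> h = act_coeff n \<beta> (g \<circ> ?\<pi>)" if "xy_monom n h = xy_monom n (g \<circ> ?\<pi>)"
      using that unfolding xy_monom_eq_iff act_coeff_def by (intro prod.cong) auto
    ultimately show ?thesis
      unfolding h act_monom[OF \<beta>] lookup_single when_def by auto
  qed
  have "coeff_of (act \<beta> p) (xy_monom n g) = (\<Sum>m\<in>Poly_Mapping.keys p.
      if m = xy_monom n (g \<circ> ?\<pi>) then act_coeff n \<beta> (g \<circ> ?\<pi>) * coeff_of p m else 0)"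
    unfolding act_sum[of \<beta> p] lookup_sum by (rule sum.cong) (simp_all add: monom)
  also have "\<dots> = act_coeff n \<beta> (g \<circ> ?\<pi>) * coeff_of p (xy_monom n (g \<circ> ?\<pi>))"
    by (simp add: in_keys_iff)
  finally show ?thesis .
qed

lemma act_in_R:
  assumes \<beta>: "\<beta> \<in> B n" and p: "p \<in> R n"
  shows "act \<beta> p \<in> R n"
  unfolding R_iff
proof (intro allI impI)
  fix m assume "coeff_of (act \<beta> p) m \<noteq> 0"
  then obtain m' where m': "m' \<in> Poly_Mapping.keys p"
      "coeff_of (act \<beta> (Poly_Mapping.single m' (coeff_of p m'))) m \<noteq> 0"
    unfolding act_sum[of \<beta> p] lookup_sum by (meson sum.neutral)
  then obtain h where "m' = xy_monom n h" using R_monomE[OF p] by blast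
  then have "m = xy_monom n (h \<circ> inv_into UNIV (index_perm n \<beta>))"
    using m'(2) by (auto simp: act_monom[OF \<beta>] lookup_single when_def split: if_splits)
  then show "Poly_Mapping.keys m \<subseteq> X ` {1..n} \<union> Y ` {1..n}" using keys_xy_monom by simp
qed

lemma R_alt_iff: "p \<in> R_alt n \<longleftrightarrow> p \<in> R n \<and> (\<forall>\<beta>\<in>B n. \<forall>g.
    act_coeff n \<beta> (g \<circ> index_perm n \<beta>) * coeff_of p (xy_monom n (g \<circ> index_perm n \<beta>)) = sign_B n \<beta> * coeff_of p (xy_monom n g))"
proof -
  have "act \<beta> p = scale c p \<longleftrightarrow> (\<forall>g. coeff_of (act \<beta> p) (xy_monom n g) = c * coeff_of p (xy_monom n g))"
    if "p \<in> R n" "\<beta> \<in> B n" for \<beta> c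
  proof
    assume eq: "\<forall>g. coeff_of (act \<beta> p) (xy_monom n g) = c * coeff_of p (xy_monom n g)"
    show "act \<beta> p = scale c p"
    proof (rule poly_mapping_eqI)
      fix m
      show "coeff_of (act \<beta> p) m = coeff_of (scale c p) m"
      proof (cases "Poly_Mapping.keys m \<subseteq> X ` {1..n} \<union> Y ` {1..n}")
        case True
        then show ?thesis using xy_monom_exhaust eq by (metis coeff_of_scale)
      next
        case False
        then have "coeff_of p m = 0" "coeff_of (act \<beta> p) m = 0"
          using that(1) act_in_R[OF that(2,1)] unfolding R_iff by blast+
        then show ?thesis by simp
      qed
    qed
  qed simp
  then show ?thesis unfolding R_alt_def using coeff_act by auto
qed

text \<open>A permutation without sign changes acts on monomials without introducing a sign, so only its
  determinant remains.\<close>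

lemma R_alt_permute:
  assumes p: "p \<in> R_alt n" and \<sigma>: "\<sigma> permutes {0..<n}"
  shows "coeff_of p (xy_monom n (g \<circ> \<sigma>)) = of_int (sign \<sigma>) * coeff_of p (xy_monom n g)"
proof -
  let ?\<beta> = "signed_perm n \<sigma> (\<lambda>_. 1)"
  have \<beta>: "?\<beta> \<in> B n" and perm: "index_perm n ?\<beta> = \<sigma>" and sgn: "\<And>i. i < n \<Longrightarrow> index_sign ?\<beta> i = 1"
    using signed_perm_B[OF \<sigma>] index_perm_signed_perm[OF \<sigma>] index_sign_signed_perm[OF \<sigma>] by simp_all
  have "act_coeff n ?\<beta> h = 1" for h by (simp add: act_coeff_def sgn)
  moreover have "sign_B n ?\<beta> = of_int (sign \<sigma>)" by (simp add: sign_B_eq[OF \<beta>] perm sgn)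
  ultimately show ?thesis
    using p \<beta> perm unfolding R_alt_iff by (metis mult_1)
qed

text \<open>The sign change of the single index \<open>i\<close> has determinant \<open>- 1\<close> and multiplies the monomial by
  \<open>- 1\<close> to the power of its total exponent at \<open>i\<close>.\<close>

lemma R_alt_odd:
  assumes p: "p \<in> R_alt n" and nz: "coeff_of p (xy_monom n g) \<noteq> 0" and i: "i < n"
  shows "odd (fst (g i) + snd (g i))"
proof -
  let ?\<epsilon> = "\<lambda>j. if j = i then - 1 else 1 :: int"
  let ?\<beta> = "signed_perm n id ?\<epsilon>"
  have \<beta>: "?\<beta> \<in> B n" and perm: "index_perm n ?\<beta> = id" and sgn: "\<And>j. j < n \<Longrightarrow> index_sign ?\<beta> j = (if j = i then - 1 else 1)"
    using signed_perm_B[OF permutes_id, of n ?\<epsilon>] index_perm_signed_perm[OF permutes_id, of n ?\<epsilon>]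
      index_sign_signed_perm[OF permutes_id, of n ?\<epsilon>] by auto
  have "act_coeff n ?\<beta> g = (\<Prod>j<n. if j = i then (- 1) ^ (fst (g i) + snd (g i)) else 1)"
    unfolding act_coeff_def by (rule prod.cong) (auto simp: sgn)
  then have "act_coeff n ?\<beta> g = (- 1) ^ (fst (g i) + snd (g i))" using i by simp
  moreover have "(\<Prod>j<n. index_sign ?\<beta> j) = (\<Prod>j<n. if j = i then - 1 else 1)"
    by (rule prod.cong) (auto simp: sgn)
  then have "sign_B n ?\<beta> = - 1" using i by (simp add: sign_B_eq[OF \<beta>] perm)
  moreover have "act_coeff n ?\<beta> (g \<circ> index_perm n ?\<beta>) * coeff_of p (xy_monom n (g \<circ> index_perm n ?\<beta>))
      = sign_B n ?\<beta> * coeff_of p (xy_monom n g)"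
    using p \<beta> unfolding R_alt_iff by blast
  ultimately have "(- 1) ^ (fst (g i) + snd (g i)) * coeff_of p (xy_monom n g) = - coeff_of p (xy_monom n g)"
    by (simp add: perm)
  then show ?thesis using nz by (cases "even (fst (g i) + snd (g i))") auto
qed

text \<open>If two exponent pairs agree, transposing them fixes the monomial but negates the coefficient.\<close>

lemma R_alt_inj:
  assumes p: "p \<in> R_alt n" and nz: "coeff_of p (xy_monom n g) \<noteq> 0"
  shows "inj_on g {0..<n}"
proof (rule inj_onI, rule ccontr)
  fix i j assume ij: "i \<in> {0..<n}" "j \<in> {0..<n}" "g i = g j" "i \<noteq> j"
  have "g \<circ> transpose i j = g" using ij(3) by (auto simp: fun_eq_iff transpose_def)
  moreover have "transpose i j permutes {0..<n}" by (rule permutes_swap_id[OF ij(1,2)])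
  ultimately have "coeff_of p (xy_monom n g) = of_int (sign (transpose i j)) * coeff_of p (xy_monom n g)"
    using R_alt_permute[OF p] by metis
  then show False using nz ij(4) by (simp add: sign_swap_id)
qed

text \<open>The expansion of the determinant of the matrix with entries \<open>x\<^sub>i\<^sup>a y\<^sub>i\<^sup>b\<close>, where \<open>(a, b)\<close> runs through
  the values of \<open>f\<close>.\<close>

definition antisym :: "nat \<Rightarrow> (nat \<Rightarrow> nat \<times> nat) \<Rightarrow> (xy, rat) mpoly" where
  "antisym n f = (\<Sum>\<sigma> | \<sigma> permutes {0..<n}. Poly_Mapping.single (xy_monom n (f \<circ> \<sigma>)) (of_int (sign \<sigma>)))"

lemma coeff_antisym: "coeff_of (antisym n f) (xy_monom n g)
    = (\<Sum>\<sigma> | \<sigma> permutes {0..<n}. of_int (sign \<sigma>) * of_bool (\<forall>i<n. f (\<sigma> i) = g i))"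
  unfolding antisym_def lookup_sum by (rule sum.cong) (auto simp: lookup_single when_def xy_monom_eq_iff)

lemma keys_antisym:
  assumes "coeff_of (antisym n f) m \<noteq> 0"
  obtains \<sigma> where "\<sigma> permutes {0..<n}" "m = xy_monom n (f \<circ> \<sigma>)"
proof -
  have "\<exists>\<sigma>\<in>{\<sigma>. \<sigma> permutes {0..<n}}.
      coeff_of (Poly_Mapping.single (xy_monom n (f \<circ> \<sigma>)) (of_int (sign \<sigma>) :: rat)) m \<noteq> 0"
    using assms unfolding antisym_def lookup_sum by (meson sum.neutral)
  then show ?thesis using that by (auto simp: lookup_single when_def split: if_splits)
qed

text \<open>Multiplying all permutations by a fixed one shows that the coefficients change by its sign. The sign
  changes contribute the product of all signs, because each is raised to an odd power.\<close>

lemma antisym_R_alt: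
  assumes odd: "\<And>i. i < n \<Longrightarrow> odd (fst (f i) + snd (f i))"
  shows "antisym n f \<in> R_alt n"
  unfolding R_alt_iff
proof (intro conjI ballI allI)
  show "antisym n f \<in> R n"
    unfolding R_iff using keys_antisym keys_xy_monom by metis
  fix \<beta> g assume \<beta>: "\<beta> \<in> B n"
  let ?\<pi> = "index_perm n \<beta>" and ?c = "\<lambda>g. coeff_of (antisym n f) (xy_monom n g)"
  have \<pi>: "?\<pi> permutes {0..<n}" by (rule index_perm_permutes[OF \<beta>])
  have lt: "\<tau> i < n \<longleftrightarrow> i < n" if "\<tau> permutes {0..<n}" for \<tau> i
    using permutes_in_image[OF that, of i] by simp
  have permute: "?c (g \<circ> ?\<pi>) = of_int (sign ?\<pi>) * ?c g"
  proof -
    have "?c (g \<circ> ?\<pi>) = (\<Sum>\<sigma> | \<sigma> permutes {0..<n}.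
        of_int (sign (\<sigma> \<circ> ?\<pi>)) * of_bool (\<forall>i<n. f ((\<sigma> \<circ> ?\<pi>) i) = (g \<circ> ?\<pi>) i))"
      unfolding coeff_antisym by (rule sum_permutations_compose_right[OF \<pi>])
    also have "\<dots> = (\<Sum>\<sigma> | \<sigma> permutes {0..<n}.
        of_int (sign ?\<pi>) * (of_int (sign \<sigma>) * of_bool (\<forall>i<n. f (\<sigma> i) = g i)))"
    proof (rule sum.cong)
      fix \<sigma> assume "\<sigma> \<in> {\<sigma>. \<sigma> permutes {0..<n}}"
      then have "sign (\<sigma> \<circ> ?\<pi>) = sign \<sigma> * sign ?\<pi>"
        using \<pi> by (auto intro!: sign_compose permutation_permutes[THEN iffD2] exI[of _ "{0..<n}"])
      moreover have "(\<forall>i<n. f (\<sigma> (?\<pi> i)) = g (?\<pi> i)) \<longleftrightarrow> (\<forall>i<n. f (\<sigma> i) = g i)"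
        using lt[OF \<pi>] lt[OF permutes_inv[OF \<pi>]] permutes_inverses[OF \<pi>] by metis
      ultimately show "of_int (sign (\<sigma> \<circ> ?\<pi>)) * of_bool (\<forall>i<n. f ((\<sigma> \<circ> ?\<pi>) i) = (g \<circ> ?\<pi>) i)
          = (of_int (sign ?\<pi>) * (of_int (sign \<sigma>) * of_bool (\<forall>i<n. f (\<sigma> i) = g i)) :: rat)"
        by simp
    qed simp
    finally show ?thesis by (simp add: coeff_antisym sum_distrib_left)
  qed
  show "act_coeff n \<beta> (g \<circ> ?\<pi>) * ?c (g \<circ> ?\<pi>) = sign_B n \<beta> * ?c g"
  proof (cases "?c (g \<circ> ?\<pi>) = 0")
    case True
    then have "?c g = 0" using permute by (auto simp: sign_def split: if_splits)
    then show ?thesis using True by simp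
  next
    case False
    then obtain \<sigma> where \<sigma>: "\<sigma> permutes {0..<n}" "xy_monom n (g \<circ> ?\<pi>) = xy_monom n (f \<circ> \<sigma>)"
      by (rule keys_antisym)
    have "act_coeff n \<beta> (g \<circ> ?\<pi>) = (\<Prod>i<n. index_sign \<beta> i)"
      unfolding act_coeff_def
    proof (rule prod.cong)
      fix i assume "i \<in> {..<n}"
      then have i: "i < n" by simp
      have "odd (fst ((g \<circ> ?\<pi>) i) + snd ((g \<circ> ?\<pi>) i))"
        using \<sigma>(2) i odd[of "\<sigma> i"] lt[OF \<sigma>(1)] unfolding xy_monom_eq_iff by simp
      then show "index_sign \<beta> i ^ (fst ((g \<circ> ?\<pi>) i) + snd ((g \<circ> ?\<pi>) i)) = index_sign \<beta> i"
        using index_sign_cases[OF \<beta> i] by auto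
    qed simp
    then show ?thesis by (simp add: permute sign_B_eq[OF \<beta>])
  qed
qed

section \<open>Dimensions of the bihomogeneous components\<close>

text \<open>A family in \<open>V\<close> that is dual to some coefficients is independent. It spans \<open>V\<close> as soon as these
  coefficients determine the elements of \<open>V\<close>.\<close>

lemma mpoly_dim_dual_family:
  fixes V :: "('v, rat) mpoly set"
  assumes V: "mpoly.subspace V" and fin: "finite T" and b: "\<And>S. S \<in> T \<Longrightarrow> b S \<in> V"
    and dual: "\<And>S S'. S \<in> T \<Longrightarrow> S' \<in> T \<Longrightarrow> coeff_of (b S) (m S') = of_bool (S = S')"
    and determined: "\<And>p. p \<in> V \<Longrightarrow> (\<And>S. S \<in> T \<Longrightarrow> coeff_of p (m S) = 0) \<Longrightarrow> p = 0"
  shows "mpoly_dim V = card T"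
proof (rule mpoly.dim_unique)
  have inj: "inj_on b T"
    using dual by (intro inj_onI) (metis of_bool_eq(1,2) zero_neq_one)
  have expand: "coeff_of (\<Sum>S\<in>T. scale (u S) (b S)) (m S') = u S'" if "S' \<in> T" for u S'
  proof -
    have "coeff_of (\<Sum>S\<in>T. scale (u S) (b S)) (m S') = (\<Sum>S\<in>T. if S = S' then u S else 0)"
      unfolding lookup_sum by (rule sum.cong) (auto simp: dual that)
    then show ?thesis using fin that by simp
  qed
  show "b ` T \<subseteq> V" using b by auto
  show "card (b ` T) = card T" by (rule card_image[OF inj])
  show "mpoly.independent (b ` T)"
  proof
    assume "mpoly.dependent (b ` T)"
    then obtain u S where S: "S \<in> T" "u (b S) \<noteq> 0" "(\<Sum>v\<in>b ` T. scale (u v) v) = 0"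
      using fin by (auto simp: mpoly.dependent_finite)
    then have "(\<Sum>S\<in>T. scale (u (b S)) (b S)) = 0" by (simp add: sum.reindex[OF inj])
    then show False using expand[OF S(1), of "\<lambda>S. u (b S)"] S(2) by simp
  qed
  show "V \<subseteq> mpoly.span (b ` T)"
  proof
    fix p assume p: "p \<in> V"
    let ?q = "\<Sum>S\<in>T. scale (coeff_of p (m S)) (b S)"
    have "?q \<in> V" by (intro mpoly.subspace_sum[OF V] mpoly.subspace_scale[OF V] b)
    then have "p - ?q = 0"
      by (intro determined mpoly.subspace_diff[OF V p]) (simp_all add: lookup_minus expand)
    moreover have "?q \<in> mpoly.span (b ` T)"
      by (intro mpoly.span_sum mpoly.span_scale mpoly.span_base) auto
    ultimately show "p \<in> mpoly.span (b ` T)" by simp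
  qed
qed

text \<open>All defining conditions are linear in the coefficients.\<close>

lemma subspace_bihom: "mpoly.subspace (bihom (R_alt n) k j)"
proof -
  have "p \<in> bihom (R_alt n) k j \<longleftrightarrow>
      (\<forall>m. coeff_of p m \<noteq> 0 \<longrightarrow> Poly_Mapping.keys m \<subseteq> X ` {1..n} \<union> Y ` {1..n} \<and> deg_x m = k \<and> deg_y m = j) \<and>
      (\<forall>\<beta>\<in>B n. \<forall>g. act_coeff n \<beta> (g \<circ> index_perm n \<beta>) * coeff_of p (xy_monom n (g \<circ> index_perm n \<beta>))
        = sign_B n \<beta> * coeff_of p (xy_monom n g))" for p
    unfolding bihom_def R_alt_iff R_iff by (auto simp: in_keys_iff)
  note iff = this
  show ?thesis
    unfolding mpoly.subspace_def
  proof (intro conjI ballI allI)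
    show "0 \<in> bihom (R_alt n) k j" by (simp add: iff)
  next
    fix p p' assume "p \<in> bihom (R_alt n) k j" "p' \<in> bihom (R_alt n) k j"
    then show "p + p' \<in> bihom (R_alt n) k j"
      unfolding iff lookup_add distrib_left by (metis add.right_neutral)
  next
    fix c p assume "p \<in> bihom (R_alt n) k j"
    then show "scale c p \<in> bihom (R_alt n) k j"
      unfolding iff coeff_of_scale mult.left_commute[of _ c] by auto
  qed
qed

text \<open>Each set of cells is given an arbitrary enumeration \<open>f S\<close>. Another enumeration differs from it by a
  permutation, so the coefficient at \<open>f S\<close> decides whether any monomial with set of exponent
  pairs \<open>S\<close> occurs.\<close>

lemma hilbert_R_alt: "hilbert (R_alt n) = gf (cell_sets n) (\<lambda>S. \<Sum>c\<in>S. c)"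
proof (rule fps_fps_eqI)
  fix j k
  let ?V = "bihom (R_alt n) k j"
  define T where "T = {S\<in>cell_sets n. (\<Sum>c\<in>S. c) = (k, j)}"
  have "\<forall>S\<in>T. \<exists>f. bij_betw f {0..<n} S"
    using ex_bij_betw_nat_finite by (auto simp: T_def cell_sets_def)
  then obtain f where f: "\<And>S. S \<in> T \<Longrightarrow> bij_betw (f S) {0..<n} S" by metis
  have sum_f: "(\<Sum>i<n. h i) = (\<Sum>c\<in>S. c)" if "bij_betw h {0..<n} S" for h and S :: "(nat \<times> nat) set"
    using sum.reindex_bij_betw[OF that, of "\<lambda>c. c"] by (simp add: atLeast0LessThan)
  have V_iff: "p \<in> ?V \<longleftrightarrow> p \<in> R_alt n \<and> (\<forall>m. coeff_of p m \<noteq> 0 \<longrightarrow> deg_x m = k \<and> deg_y m = j)" for p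
    by (auto simp: bihom_def in_keys_iff)
  have "mpoly_dim ?V = card T"
  proof (rule mpoly_dim_dual_family[where b = "\<lambda>S. antisym n (f S)" and m = "\<lambda>S. xy_monom n (f S)"])
    show "mpoly.subspace ?V" by (rule subspace_bihom)
    show "finite T"
    proof (rule finite_subset)
      show "T \<subseteq> Pow ({0..k} \<times> {0..j})"
      proof
        fix S assume S: "S \<in> T"
        have "c \<in> {0..k} \<times> {0..j}" if "c \<in> S" for c
          using S that member_le_sum[of c S fst] member_le_sum[of c S snd]
          by (auto simp: T_def cell_sets_def prod_eq_iff fst_sum snd_sum mem_Times_iff)
        then show "S \<in> Pow ({0..k} \<times> {0..j})" by blast
      qed
    qed simp
  next
    fix S assume S: "S \<in> T"
    have odd: "odd (fst (f S i) + snd (f S i))" if "i < n" for i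
    proof -
      have "f S i \<in> S" using bij_betwE[OF f[OF S]] that by simp
      then have "f S i \<in> cells" using S by (auto simp: T_def cell_sets_def)
      then show ?thesis by (auto simp: cells_def)
    qed
    show "antisym n (f S) \<in> ?V"
      unfolding V_iff
    proof (intro conjI allI impI)
      show "antisym n (f S) \<in> R_alt n" using antisym_R_alt odd .
      fix m assume "coeff_of (antisym n (f S)) m \<noteq> 0"
      then obtain \<sigma> where \<sigma>: "\<sigma> permutes {0..<n}" "m = xy_monom n (f S \<circ> \<sigma>)" by (rule keys_antisym)
      have "bij_betw (f S \<circ> \<sigma>) {0..<n} S" by (rule bij_betw_trans[OF permutes_imp_bij[OF \<sigma>(1)] f[OF S]])
      then have "(\<Sum>i<n. (f S \<circ> \<sigma>) i) = (\<Sum>c\<in>S. c)" by (rule sum_f)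
      then have "(\<Sum>i<n. (f S \<circ> \<sigma>) i) = (k, j)" using S by (simp add: T_def)
      then show "deg_x m = k" "deg_y m = j" by (simp_all add: \<sigma>(2) deg_xy_monom)
    qed
    fix S' assume S': "S' \<in> T"
    have "(\<forall>i<n. f S (\<sigma> i) = f S' i) \<longleftrightarrow> S = S' \<and> \<sigma> = id" if \<sigma>: "\<sigma> permutes {0..<n}" for \<sigma>
    proof
      assume eq: "\<forall>i<n. f S (\<sigma> i) = f S' i"
      have "S = (f S \<circ> \<sigma>) ` {0..<n}"
        using bij_betw_trans[OF permutes_imp_bij[OF \<sigma>] f[OF S]] by (simp add: bij_betw_def)
      also have "\<dots> = f S' ` {0..<n}" using eq by auto
      also have "\<dots> = S'" using f[OF S'] by (simp add: bij_betw_def)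
      finally have SS': "S = S'" .
      have "\<sigma> i = i" for i
      proof (cases "i < n")
        case True
        then show ?thesis
          using eq SS' bij_betw_imp_inj_on[OF f[OF S]] permutes_in_image[OF \<sigma>, of i]
          by (auto dest: inj_onD)
      qed (use permutes_not_in[OF \<sigma>] in simp)
      then show "S = S' \<and> \<sigma> = id" using SS' by auto
    qed auto
    then have "coeff_of (antisym n (f S)) (xy_monom n (f S'))
        = (\<Sum>\<sigma> | \<sigma> permutes {0..<n}. if \<sigma> = id then of_bool (S = S') else 0)"
      unfolding coeff_antisym by (intro sum.cong) auto
    then show "coeff_of (antisym n (f S)) (xy_monom n (f S')) = of_bool (S = S')"
      by (simp add: finite_permutations permutes_id)
  next
    fix p assume p: "p \<in> ?V" and zero: "\<And>S. S \<in> T \<Longrightarrow> coeff_of p (xy_monom n (f S)) = 0"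
    have alt: "p \<in> R_alt n" using p by (simp add: V_iff)
    show "p = 0"
    proof (rule ccontr)
      assume "p \<noteq> 0"
      then obtain m where m: "coeff_of p m \<noteq> 0" by (metis poly_mapping_eqI lookup_zero)
      then obtain g where g: "m = xy_monom n g"
        using alt R_monomE[of p n m] by (auto simp: R_alt_def in_keys_iff)
      define S where "S = g ` {0..<n}"
      have inj: "inj_on g {0..<n}" using R_alt_inj[OF alt] m g by simp
      then have bij_g: "bij_betw g {0..<n} S" by (simp add: S_def bij_betw_def)
      have "S \<in> T"
      proof -
        have "(\<Sum>c\<in>S. c) = (k, j)"
          using p m g unfolding sum_f[OF bij_g, symmetric] V_iff prod_eq_iff by (metis deg_xy_monom fst_conv snd_conv)
        moreover have "S \<subseteq> cells"
          using R_alt_odd[OF alt m[unfolded g]] by (auto simp: S_def cells_def case_prod_unfold)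
        ultimately show ?thesis using card_image[OF inj] by (simp add: T_def cell_sets_def S_def)
      qed
      define \<sigma> where "\<sigma> i = (if i < n then inv_into {0..<n} g (f S i) else i)" for i
      have "bij_betw (inv_into {0..<n} g \<circ> f S) {0..<n} {0..<n}"
        by (rule bij_betw_trans[OF f[OF \<open>S \<in> T\<close>] bij_betw_inv_into[OF bij_g]])
      moreover have "(inv_into {0..<n} g \<circ> f S) i = \<sigma> i" if "i \<in> {0..<n}" for i
        using that by (simp add: \<sigma>_def)
      then have "bij_betw (inv_into {0..<n} g \<circ> f S) {0..<n} {0..<n} = bij_betw \<sigma> {0..<n} {0..<n}"
        by (rule bij_betw_cong)
      ultimately have "bij_betw \<sigma> {0..<n} {0..<n}" by simp
      then have \<sigma>: "\<sigma> permutes {0..<n}" by (rule bij_imp_permutes) (simp add: \<sigma>_def)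
      have "g (\<sigma> i) = f S i" if "i < n" for i
        using that bij_betw_inv_into_right[OF bij_g] bij_betwE[OF f[OF \<open>S \<in> T\<close>]] by (simp add: \<sigma>_def)
      then have "xy_monom n (g \<circ> \<sigma>) = xy_monom n (f S)" by (simp add: xy_monom_eq_iff)
      then have "of_int (sign \<sigma>) * coeff_of p (xy_monom n g) = 0"
        using R_alt_permute[OF alt \<sigma>, of g] zero[OF \<open>S \<in> T\<close>] by simp
      then show False using m g by (simp add: sign_def split: if_splits)
    qed
  qed
  then show "hilbert (R_alt n) $ j $ k = gf (cell_sets n) (\<lambda>S. \<Sum>c\<in>S. c) $ j $ k"
    by (simp add: hilbert_def gf_nth T_def)
qed

section \<open>The bigraded Hilbert series\<close>

theorem mainTheorem3:
  fixes n :: nat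
  assumes "n \<ge> 1"
  shows "hilbert (R_alt n) = pleth_e n (\<lambda>q t. (q + t) / ((1 - q ^ 2) * (1 - t ^ 2))) \<and>
    pleth_e n (\<lambda>q t. (q + t) / ((1 - q ^ 2) * (1 - t ^ 2))) =
      (\<Sum>\<beta>\<in>B n. q_fps ^ fmaj n \<beta> * t_fps ^ (n ^ 2 - fmaj n (inv_into UNIV \<beta>)))
        * (\<Prod>i=1..n. 1 / (1 - q_fps ^ (2 * i))) * (\<Prod>i=1..n. 1 / (1 - t_fps ^ (2 * i)))"
  by (simp only: hilbert_R_alt pleth_e_cells gf_cell_sets)

end
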